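(* Assume the linear model with tie probability $T(s)=0$, i.e. $\beta=\tfrac12$ (as defined in the context), and let $\mu=\mathbb E[X_\sigma]$, which does not depend on the ordering $\sigma$. Let $k\in\{0,1,\dots,n\}$ be an integer. (1) If $k\ge\mu+2$, then, over all orderings $\sigma$, $\mathbb P(X_\sigma\ge k)$ is maximized by $\sigma=(1,2,\dots,n)$, i.e. $\sigma(i)=i$ for all $i$. (2) If $k\le\mu-1$, then, over all orderings $\sigma$, $\mathbb P(X_\sigma\ge k)$ is maximized by $\sigma=(n,n-1,\dots,1)$, i.e. $\sigma(i)=n+1-i$ for all $i$. (3) For $k\in(\mu-1,\mu+2)$, the optimal ordering (the ordering $\sigma$ maximizing $\mathbb P(X_\sigma\ge k)$) may depend on how the teams $A$ and $B$ are chosen.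
   Context: Let $n\ge1$. Team $A$ has players of strengths $a_1\ge a_2\ge\dots\ge a_n$ and team $B$ has players of strengths $b_1\ge b_2\ge\dots\ge b_n$ (real numbers). An ordering is a permutation $\sigma$ of $\{1,\dots,n\}$, written in one-line notation $(\sigma(1),\dots,\sigma(n))$; in match $i$, player $\sigma(i)$ of team $B$ plays player $i$ of team $A$. The random variable $X_{j,i}$ is the number of points earned by team $B$ when its player $j$ faces player $i$ of team $A$: $1$ for a win, $0$ for a loss (ties have probability zero here). The total score of team $B$ under the ordering $\sigma$ is $X_\sigma=X_{\sigma(1),1}+\dots+X_{\sigma(n),n}$, where the match outcomes $X_{\sigma(1),1},\dots,X_{\sigma(n),n}$ are independent. In the linear model with constants $\alpha>0$ and $\beta=\tfrac12$, writing $s=b_j-a_i$ for the strength differential, $\mathbb P(X_{j,i}=1)=W(s)=\alpha s+\tfrac12$ and $\mathbb P(X_{j,i}=0)=L(s)=-\alpha s+\tfrac12$, so the tie probability is $T(s)=1-2\beta=0$; all possible strength differentials are assumed to lie in $(-\tfrac{1}{2\alpha},\tfrac{1}{2\alpha})$. *)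

theory Defs
  imports "HOL-Probability.Probability" "HOL-Combinatorics.Permutations"
begin

definition win_prob :: "real \<Rightarrow> real \<Rightarrow> real" where
  "win_prob \<alpha> s = \<alpha> * s + 1 / 2"

definition loss_prob :: "real \<Rightarrow> real \<Rightarrow> real" where
  "loss_prob \<alpha> s = - \<alpha> * s + 1 / 2"

text \<open>
  Players are indexed by \<open>{1..n}\<close>; values of \<open>a\<close>, \<open>b\<close>, \<open>X\<close> outside this range are irrelevant.
  \<open>X j i\<close> is the number of points that player \<open>j\<close> of team B earns against player \<open>i\<close> of team A.
  Only the outcomes belonging to one and the same ordering are required to be independent.
\<close>

locale linear_model = prob_space M for M :: "'w measure" +
  fixes n :: nat
    and \<alpha> :: real
    and a b :: "nat \<Rightarrow> real"
    and X :: "nat \<Rightarrow> nat \<Rightarrow> 'w \<Rightarrow> real"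
  assumes n_ge_1: "n \<ge> 1"
    and alpha_pos: "\<alpha> > 0"
    and a_decreasing: "antimono_on {1..n} a"
    and b_decreasing: "antimono_on {1..n} b"
    and differential_range:
      "\<And>i j. i \<in> {1..n} \<Longrightarrow> j \<in> {1..n} \<Longrightarrow>
        b j - a i \<in> {- 1 / (2 * \<alpha>) <..< 1 / (2 * \<alpha>)}"
    and points_measurable:
      "\<And>i j. i \<in> {1..n} \<Longrightarrow> j \<in> {1..n} \<Longrightarrow> random_variable borel (X j i)"
    and prob_win:
      "\<And>i j. i \<in> {1..n} \<Longrightarrow> j \<in> {1..n} \<Longrightarrow>
        prob {\<omega> \<in> space M. X j i \<omega> = 1} = win_prob \<alpha> (b j - a i)"
    and prob_loss:
      "\<And>i j. i \<in> {1..n} \<Longrightarrow> j \<in> {1..n} \<Longrightarrow>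
        prob {\<omega> \<in> space M. X j i \<omega> = 0} = loss_prob \<alpha> (b j - a i)"
    and outcomes_indep:
      "\<And>\<sigma>. \<sigma> permutes {1..n} \<Longrightarrow>
        indep_vars (\<lambda>_. borel) (\<lambda>i. X (\<sigma> i) i) {1..n}"

definition total_score ::
    "nat \<Rightarrow> (nat \<Rightarrow> nat \<Rightarrow> 'w \<Rightarrow> real) \<Rightarrow> (nat \<Rightarrow> nat) \<Rightarrow> 'w \<Rightarrow> real" where
  "total_score n X \<sigma> \<omega> = (\<Sum>i=1..n. X (\<sigma> i) i \<omega>)"

definition expected_score ::
    "'w measure \<Rightarrow> nat \<Rightarrow> (nat \<Rightarrow> nat \<Rightarrow> 'w \<Rightarrow> real) \<Rightarrow> (nat \<Rightarrow> nat) \<Rightarrow> real" where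
  "expected_score M n X \<sigma> = integral\<^sup>L M (total_score n X \<sigma>)"

definition score_prob ::
    "'w measure \<Rightarrow> nat \<Rightarrow> (nat \<Rightarrow> nat \<Rightarrow> 'w \<Rightarrow> real) \<Rightarrow> nat \<Rightarrow> (nat \<Rightarrow> nat) \<Rightarrow> real" where
  "score_prob M n X k \<sigma> = measure M {\<omega> \<in> space M. total_score n X \<sigma> \<omega> \<ge> real k}"

text \<open>Optimality does not include uniqueness: several orderings may attain the maximum.\<close>

definition optimal_ordering ::
    "'w measure \<Rightarrow> nat \<Rightarrow> (nat \<Rightarrow> nat \<Rightarrow> 'w \<Rightarrow> real) \<Rightarrow> nat \<Rightarrow> (nat \<Rightarrow> nat) \<Rightarrow> bool" where
  "optimal_ordering M n X k \<sigma> \<longleftrightarrow>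
     \<sigma> permutes {1..n} \<and>
     (\<forall>\<tau>. \<tau> permutes {1..n} \<longrightarrow> score_prob M n X k \<tau> \<le> score_prob M n X k \<sigma>)"

text \<open>\<open>permutes\<close> requires the identity outside \<open>{1..n}\<close>, hence the case distinction.\<close>

definition reverse_ordering :: "nat \<Rightarrow> nat \<Rightarrow> nat" where
  "reverse_ordering n i = (if i \<in> {1..n} then n + 1 - i else i)"

end

theory Submission
  imports Defs "HOL-Real_Asymp.Real_Asymp"
begin

text \<open>
  Let two opponents trade their challengers. In the linear model the sum of the two winning
  probabilities stays the same and only their product \<open>q\<close> changes; it is larger when the stronger player
  meets the stronger opponent. The probability of scoring at least \<open>k\<close> is affine in \<open>q\<close> with slope
  \<open>P(R = k - 2) - P(R = k - 1)\<close>, where \<open>R\<close> is the score from the other matches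
  (\<open>pgf_pair_diff\<close>, \<open>sum_coeff_diff\<close>, \<open>score_prob_swap\<close>).

  The score \<open>R\<close> is a sum of independent \<open>0\<close>-\<open>1\<close> variables with mean strictly between \<open>\<mu> - 2\<close> and
  \<open>\<mu>\<close>. By a theorem of Darroch (\<open>pgf_mode\<close>) its point probabilities increase weakly up to its mean
  and decrease weakly from there on. So the slope is nonnegative if \<open>k \<ge> \<mu> + 2\<close> and nonpositive if
  \<open>k \<le> \<mu> - 1\<close>. In the first case exchanges that remove an inversion never hurt and lead to the
  identity, in the second case exchanges that create one lead to the reversal (\<open>permutation_sorting\<close>,
  \<open>permutation_reverse_sorting\<close>). Darroch's theorem itself follows from Hoeffding's observation
  (\<open>pgf_minimized_by_equal_interior\<close>) that a linear functional of the distribution, at fixed mean, is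
  smallest for a shifted binomial distribution.

  Between these bounds both signs of the slope occur. To exploit this, all opponents but the weakest
  are made equally strong, so that an ordering reduces to the choice of the player who meets the
  weakest opponent. For \<open>k = 2\<close> and \<open>d < 1\<close> there is a team in which this must be the best player, and
  another one with the same mean in which it must not be (\<open>conflicting_profile_parameters\<close>).
  Interchanging wins and losses covers \<open>d \<ge> 1\<close>.
\<close>

section \<open>Generating functions of sums of independent zero-one variables\<close>

lemma sum_remove_pair:
  fixes f :: "'a \<Rightarrow> real"
  assumes "finite A" "i \<in> A" "j \<in> A" "i \<noteq> j"
  shows "sum f A = f i + f j + sum f (A - {i, j})"
proof -
  have "A - {i} - {j} = A - {i, j}" by auto
  then show ?thesis
    using assms sum.remove[of A i f] sum.remove[of "A - {i}" j f] by simp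
qed

text \<open>
  The generating function of a sum of independent \<open>0\<close>-\<open>1\<close> variables with success probabilities
  \<open>p i\<close>. As a polynomial it makes the exchange of two factors a ring identity.
\<close>

definition pgf :: "('a \<Rightarrow> real) \<Rightarrow> 'a set \<Rightarrow> real poly" where
  "pgf p I = (\<Prod>i\<in>I. [:1 - p i, p i:])"

lemma pgf_remove_pair:
  assumes "finite I" "i \<in> I" "j \<in> I" "i \<noteq> j"
  shows "pgf p I = [:1 - p i, p i:] * [:1 - p j, p j:] * pgf p (I - {i, j})"
proof -
  have "pgf p I = [:1 - p i, p i:] * pgf p (I - {i})"
    unfolding pgf_def using assms by (simp add: prod.remove)
  also have "pgf p (I - {i}) = [:1 - p j, p j:] * pgf p (I - {i} - {j})"
    unfolding pgf_def using assms by (subst prod.remove[of _ j]) auto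
  also have "I - {i} - {j} = I - {i, j}" by auto
  finally show ?thesis by (simp only: mult.assoc)
qed

text \<open>
  Two matches enter the score distribution only through the sum and the product of their winning
  probabilities. In the linear model an exchange of opponents preserves the sum, so everything
  depends on how it changes the product.
\<close>

lemma pair_factor:
  fixes p q :: real
  shows "[:1 - p, p:] * [:1 - q, q:] = [:1 - (p + q), p + q:] + smult (p * q) ([:1, -1:] * [:1, -1:])"
  by (simp add: algebra_simps)

lemma pgf_pair_diff:
  assumes "finite I" "i \<in> I" "j \<in> I" "i \<noteq> j"
    and "\<And>l. l \<in> I - {i, j} \<Longrightarrow> q l = p l" and "q i + q j = p i + p j"
  shows "pgf q I = pgf p I
    + smult (q i * q j - p i * p j) ([:1, -1:] * ([:1, -1:] * pgf p (I - {i, j})))"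
proof -
  have R: "pgf q (I - {i, j}) = pgf p (I - {i, j})"
    unfolding pgf_def using assms(5) by (intro prod.cong) auto
  have ring: "(U + smult y (D * D)) * W = (U + smult x (D * D)) * W + smult (y - x) (D * (D * W))"
    for U D W :: "real poly" and x y
    by (simp add: distrib_right smult_diff_left mult.assoc)
  show ?thesis
    unfolding pgf_remove_pair[OF assms(1-4)] R pair_factor assms(6) by (rule ring)
qed

text \<open>
  The factor \<open>1 - x\<close> undoes summation, so the probability of at most \<open>m\<close> points reacts to an
  exchange through one coefficient of \<open>(1 - x)\<close> times the generating function of the other matches,
  that is, through one difference of neighbouring point probabilities.
\<close>

lemma sum_coeff_diff:
  fixes Q :: "real poly"
  shows "(\<Sum>j<Suc m. coeff ([:1, -1:] * Q) j) = coeff Q m"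
  by (induction m) (auto simp: coeff_pCons)

lemma coeff_pgf_nonneg:
  assumes "finite I" "\<And>i. i \<in> I \<Longrightarrow> 0 \<le> p i \<and> p i \<le> 1"
  shows "0 \<le> coeff (pgf p I) j"
  using assms
proof (induction I arbitrary: j rule: finite_induct)
  case empty
  then show ?case by (simp add: pgf_def coeff_1)
next
  case (insert i I)
  have "pgf p (insert i I) = [:1 - p i, p i:] * pgf p I"
    using insert by (simp add: pgf_def)
  then show ?case
    using insert.IH insert.prems by (cases j) (auto simp: coeff_pCons)
qed

text \<open>
  The recursion \<open>(j + 1) (1 - w) f (j + 1) = (N - j) w f j\<close> of the binomial weights, arranged to show
  where they change from increasing to decreasing.
\<close>

lemma binomial_coeff_step:
  fixes w :: real
  shows "real (Suc j) * (1 - w) * (coeff ([:1 - w, w:] ^ N) (Suc j) - coeff ([:1 - w, w:] ^ N) j)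
    = (real (Suc N) * w - real (Suc j)) * coeff ([:1 - w, w:] ^ N) j"
proof -
  let ?Q = "[:1 - w, w:] ^ N"
  \<comment> \<open>Comparing coefficients in this differential equation avoids the truncated exponent \<open>N - j\<close>.\<close>
  have "pderiv ?Q * [:1 - w, w:] = smult (real N * w) ?Q"
  proof (cases N)
    case (Suc m)
    have "[:1 - w, w:] ^ m * [:w:] = smult w ([:1 - w, w:] ^ m)" by simp
    then have "pderiv ([:1 - w, w:] ^ N) = smult (real N * w) ([:1 - w, w:] ^ m)"
      unfolding Suc pderiv_power_Suc by (simp add: pderiv_pCons del: power_Suc mult_pCons_left mult_pCons_right)
    then show ?thesis by (simp only: mult_smult_left) (simp only: Suc power_Suc2)
  qed simp
  then have "coeff (pderiv ?Q * [:1 - w, w:]) j = coeff (smult (real N * w) ?Q) j" by simp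
  then have "(1 - w) * real (Suc j) * coeff ?Q (Suc j) + w * real j * coeff ?Q j
      = real N * w * coeff ?Q j"
    by (cases j) (auto simp: coeff_pderiv coeff_pCons algebra_simps)
  then show ?thesis by (simp add: algebra_simps)
qed

lemma binomial_coeff_pos:
  fixes w :: real
  assumes "0 < w" "w < 1" "j \<le> N"
  shows "0 < coeff ([:1 - w, w:] ^ N) j"
  using assms(3)
proof (induction N arbitrary: j)
  case 0
  then show ?case by simp
next
  case (Suc N)
  have nn: "0 \<le> coeff ([:1 - w, w:] ^ N) i" for i
    using coeff_pgf_nonneg[of "{..<N}" "\<lambda>_. w" i] assms by (simp add: pgf_def)
  show ?case
  proof (cases j)
    case 0
    then show ?thesis using Suc.IH[of 0] assms by simp
  next
    case (Suc i)
    then have "0 < w * coeff ([:1 - w, w:] ^ N) i"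
      using Suc.IH[of i] Suc.prems assms by simp
    moreover have "0 \<le> (1 - w) * coeff ([:1 - w, w:] ^ N) j"
      using nn assms by simp
    ultimately show ?thesis using Suc by simp
  qed
qed

section \<open>The mode lies next to the mean\<close>

text \<open>
  Hoeffding's extremal principle: on the vectors in \<open>[0, 1]\<close> with a prescribed sum, a linear
  functional of the generating function is smallest at a vector whose entries other than \<open>0\<close> and
  \<open>1\<close> all coincide. The functional is affine in the product of any two entries with fixed sum. If its
  slope is nonnegative, the product is made as small as possible by pushing one of the two entries
  to the boundary; if the slope is negative, the product is increased by moving an entry below and
  one above the average towards each other until one of them equals the average. The first move
  lowers the number of interior entries; the second keeps it, leaves their average unchanged and
  lowers the number of interior entries that differ from it. So the process terminates.
\<close>

lemma pgf_minimized_by_equal_interior: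
  fixes L :: "real poly \<Rightarrow> real" and p :: "'a \<Rightarrow> real"
  assumes fin: "finite I"
    and add: "\<And>P Q. L (P + Q) = L P + L Q" and smult: "\<And>c P. L (smult c P) = c * L P"
    and p01: "\<And>i. i \<in> I \<Longrightarrow> 0 \<le> p i \<and> p i \<le> 1"
  shows "\<exists>q c. 0 < c \<and> c < 1 \<and> (\<forall>i\<in>I. q i \<in> {0, c, 1}) \<and> sum q I = sum p I
    \<and> L (pgf q I) \<le> L (pgf p I)"
proof -
  define J where "J p = {i \<in> I. 0 < p i \<and> p i < 1}" for p :: "'a \<Rightarrow> real"
  define avg where "avg p = sum p (J p) / real (card (J p))" for p :: "'a \<Rightarrow> real"
  define D where "D p = {i \<in> J p. p i \<noteq> avg p}" for p :: "'a \<Rightarrow> real"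
  have finJ: "finite (J p)" for p unfolding J_def using fin by auto
  have finD: "finite (D p)" for p unfolding D_def using finJ by auto
  have "(\<forall>i\<in>I. 0 \<le> p i \<and> p i \<le> 1) \<longrightarrow>
    (\<exists>q c. 0 < c \<and> c < 1 \<and> (\<forall>i\<in>I. q i \<in> {0, c, 1}) \<and> sum q I = sum p I
      \<and> L (pgf q I) \<le> L (pgf p I))" (is "?B p \<longrightarrow> ?C p")
  proof (induction p rule: wf_induct_rule[OF wf_measures[of "[\<lambda>p. card (J p), \<lambda>p. card (D p)]"]])
    case (1 p)
    show ?case
    proof
      assume B: "?B p"
      have step: "?C p"
        if "?B q" "sum q I = sum p I" "L (pgf q I) \<le> L (pgf p I)"
          "card (J q) < card (J p) \<or> card (J q) = card (J p) \<and> card (D q) < card (D p)" for q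
      proof -
        have "?C q" using 1[of q] that by auto
        then show ?thesis using that by (metis (no_types, lifting) order_trans)
      qed
      show "?C p"
      proof (cases "D p = {}")
        case True
        show ?thesis
        proof (cases "J p = {}")
          case True
          then have "\<forall>i\<in>I. p i \<in> {0, 1/2, 1}" using B unfolding J_def by force
          then show ?thesis by (intro exI[of _ p] exI[of _ "1/2"]) auto
        next
          case False
          then obtain i where i: "i \<in> J p" by auto
          then have "p i = avg p" using True unfolding D_def by auto
          then have "0 < avg p" "avg p < 1" using i unfolding J_def by auto
          moreover have "\<forall>i\<in>I. p i \<in> {0, avg p, 1}"
            using B True unfolding D_def J_def by force
          ultimately show ?thesis by blast
        qed
      next
        case False
        let ?c = "avg p"
        have cardJ: "card (J p) > 0"
          using False finJ[of p] unfolding D_def by (auto simp: card_gt_0_iff)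
        \<comment> \<open>Not all interior entries equal their average, so one lies below it and one above.\<close>
        have zero: "(\<Sum>i\<in>J p. p i - ?c) = 0"
          using cardJ by (simp add: sum_subtractf avg_def)
        obtain i where i: "i \<in> J p" "p i < ?c"
        proof (rule ccontr)
          assume "\<not> thesis"
          then have "\<forall>i\<in>J p. 0 \<le> p i - ?c" using that by force
          then have "\<forall>i\<in>J p. p i - ?c = 0"
            using zero sum_nonneg_eq_0_iff[OF finJ, of p "\<lambda>i. p i - ?c"] by auto
          then show False using False unfolding D_def by auto
        qed
        obtain j where j: "j \<in> J p" "?c < p j"
        proof (rule ccontr)
          assume "\<not> thesis"
          then have "\<forall>i\<in>J p. 0 \<le> ?c - p i" using that by force
          moreover have "(\<Sum>i\<in>J p. ?c - p i) = 0"
            using zero by (simp add: sum_subtractf)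
          ultimately have "\<forall>i\<in>J p. ?c - p i = 0"
            using sum_nonneg_eq_0_iff[OF finJ, of p "\<lambda>i. ?c - p i"] by auto
          then show False using False unfolding D_def by auto
        qed
        have ij: "i \<noteq> j" "i \<in> I" "j \<in> I" and pi: "0 < p i" "p i < 1" and pj: "0 < p j" "p j < 1"
          using i j unfolding J_def by auto
        define R where "R = [:1, -1:] * ([:1, -1:] * pgf p (I - {i, j}))"
        define upd where "upd x = p(i := x, j := p i + p j - x)" for x
        have sum_upd: "sum (upd x) A = sum p A" if "A \<subseteq> I" "i \<in> A" "j \<in> A" for x A
        proof -
          have "finite A" using that fin finite_subset by auto
          then have "sum f A = f i + f j + sum f (A - {i, j})" for f :: "'a \<Rightarrow> real"
            using that ij by (intro sum_remove_pair)
          moreover have "sum (upd x) (A - {i, j}) = sum p (A - {i, j})"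
            by (intro sum.cong) (auto simp: upd_def)
          ultimately show ?thesis using ij by (simp add: upd_def)
        qed
        have L_upd: "L (pgf (upd x) I) = L (pgf p I) + (x * (p i + p j - x) - p i * p j) * L R" for x
        proof -
          have "pgf (upd x) I = pgf p I + smult (upd x i * upd x j - p i * p j) R"
            unfolding R_def
            by (rule pgf_pair_diff[OF fin]) (use ij in \<open>auto simp: upd_def\<close>)
          then show ?thesis using ij by (simp add: add smult upd_def)
        qed
        show ?thesis
        proof (cases "0 \<le> L R")
          case True
          define x :: real where "x = (if p i + p j \<le> 1 then 0 else 1)"
          have "x * (p i + p j - x) - p i * p j \<le> 0"
          proof (cases "p i + p j \<le> 1")
            case True
            then show ?thesis using pi pj by (simp add: x_def)
          next
            case False
            have "0 \<le> (1 - p i) * (1 - p j)" using pi pj by simp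
            then show ?thesis using False by (simp add: x_def algebra_simps)
          qed
          then have "(x * (p i + p j - x) - p i * p j) * L R \<le> 0"
            using True by (rule mult_nonpos_nonneg)
          then have "L (pgf (upd x) I) \<le> L (pgf p I)" using L_upd by simp
          moreover have "?B (upd x)" using B pi pj by (auto simp: upd_def x_def)
          moreover have "card (J (upd x)) < card (J p)"
          proof (rule psubset_card_mono[OF finJ])
            have "i \<notin> J (upd x)" using ij by (auto simp: J_def upd_def x_def)
            moreover have "J (upd x) \<subseteq> J p"
              using ij pi pj by (auto simp: J_def upd_def split: if_splits)
            ultimately show "J (upd x) \<subset> J p" using i by auto
          qed
          ultimately show ?thesis using step sum_upd[of I] ij by blast
        next
          case False
          have c: "0 < ?c" "?c < 1" using i j pi pj by auto
          have Jeq: "J (upd ?c) = J p"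
            using ij pi pj i j c by (auto simp: J_def upd_def)
          have avg: "avg (upd ?c) = ?c"
            using sum_upd[of "J p" ?c] i j Jeq by (simp add: avg_def J_def)
          have "?c * (p i + p j - ?c) - p i * p j = (?c - p i) * (p j - ?c)"
            by (simp add: algebra_simps)
          then have "0 \<le> ?c * (p i + p j - ?c) - p i * p j" using i j by simp
          then have "(?c * (p i + p j - ?c) - p i * p j) * L R \<le> 0"
            using False by (intro mult_nonneg_nonpos) auto
          then have "L (pgf (upd ?c) I) \<le> L (pgf p I)" using L_upd by simp
          moreover have "?B (upd ?c)" using B pi pj i j c by (auto simp: upd_def)
          moreover have "card (D (upd ?c)) < card (D p)"
          proof (rule psubset_card_mono[OF finD])
            have "upd ?c i = ?c" using ij by (simp add: upd_def)
            then have "i \<notin> D (upd ?c)" by (simp add: D_def avg)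
            moreover have "i \<in> D p" "j \<in> D p" using i j by (auto simp: D_def)
            moreover have "D (upd ?c) \<subseteq> insert j (D p)"
              unfolding D_def avg Jeq by (auto simp: upd_def split: if_splits)
            ultimately show "D (upd ?c) \<subset> D p" by auto
          qed
          ultimately show ?thesis using step sum_upd[of I] ij Jeq by (metis order_refl)
        qed
      qed
    qed
  qed
  then show ?thesis using p01 by blast
qed

lemma pgf_three_values:
  assumes "finite I" "\<forall>i\<in>I. q i \<in> {0, c, 1}" "0 < c" "c < 1"
  shows "pgf q I = monom 1 (card {i\<in>I. q i = 1}) * [:1 - c, c:] ^ card {i\<in>I. q i = c}"
    and "sum q I = real (card {i\<in>I. q i = 1}) + real (card {i\<in>I. q i = c}) * c"
proof -
  have I: "I = {i\<in>I. q i = 0} \<union> ({i\<in>I. q i = 1} \<union> {i\<in>I. q i = c})"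
    using assms by auto
  show "pgf q I = monom 1 (card {i\<in>I. q i = 1}) * [:1 - c, c:] ^ card {i\<in>I. q i = c}"
    unfolding pgf_def
    by (subst I, subst prod.union_disjoint; (subst prod.union_disjoint)?)
       (use assms in \<open>auto simp: monom_altdef one_pCons[symmetric]\<close>)
  show "sum q I = real (card {i\<in>I. q i = 1}) + real (card {i\<in>I. q i = c}) * c"
    by (subst I, subst sum.union_disjoint; (subst sum.union_disjoint)?)
       (use assms in auto)
qed

text \<open>
  Sure successes shift a binomial distribution and sure failures do not affect it, so for such
  vectors the position of the mode is read off from the binomial step.
\<close>

lemma three_values_mode:
  assumes "finite I" "\<forall>i\<in>I. q i \<in> {0, c, 1}" "0 < c" "c < 1"
  shows "sum q I \<le> real j \<Longrightarrow> coeff (pgf q I) (Suc j) \<le> coeff (pgf q I) j"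
    and "real (Suc j) \<le> sum q I \<Longrightarrow> coeff (pgf q I) j \<le> coeff (pgf q I) (Suc j)"
proof -
  define r where "r = card {i\<in>I. q i = 1}"
  define t where "t = card {i\<in>I. q i = c}"
  define f where "f = coeff ([:1 - c, c:] ^ t)"
  have W: "coeff (pgf q I) l = (if l < r then 0 else f (l - r))" for l
    unfolding pgf_three_values(1)[OF assms] by (simp add: coeff_monom_mult r_def t_def f_def)
  have S: "sum q I = real r + real t * c"
    unfolding pgf_three_values(2)[OF assms] by (simp add: r_def t_def)
  have f0: "0 \<le> f l" for l
    using coeff_pgf_nonneg[of "{..<t}" "\<lambda>_. c" l] assms by (simp add: pgf_def f_def)
  have stp: "real (Suc l) * (1 - c) * (f (Suc l) - f l) = (real (Suc t) * c - real (Suc l)) * f l" for l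
    unfolding f_def by (rule binomial_coeff_step)
  show "coeff (pgf q I) (Suc j) \<le> coeff (pgf q I) j" if "sum q I \<le> real j"
  proof -
    have "0 \<le> real t * c" using assms by simp
    then have jr: "r \<le> j" using that S by linarith
    have "real (Suc t) * c - real (Suc (j - r)) \<le> 0"
      using that S assms jr by (simp add: algebra_simps of_nat_diff)
    then have "real (Suc (j - r)) * (1 - c) * (f (Suc (j - r)) - f (j - r)) \<le> 0"
      unfolding stp using f0 by (rule mult_nonpos_nonneg)
    then have "f (Suc (j - r)) - f (j - r) \<le> 0"
      using assms by (simp add: mult_le_0_iff)
    then show ?thesis using jr by (simp add: W Suc_diff_le)
  qed
  show "coeff (pgf q I) j \<le> coeff (pgf q I) (Suc j)" if "real (Suc j) \<le> sum q I"
  proof (cases "r \<le> j")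
    case True
    have "0 \<le> real (Suc t) * c - real (Suc (j - r))"
      using that S assms True by (simp add: algebra_simps of_nat_diff)
    then have "0 \<le> real (Suc (j - r)) * (1 - c) * (f (Suc (j - r)) - f (j - r))"
      unfolding stp using f0 by (rule mult_nonneg_nonneg)
    moreover have "0 < real (Suc (j - r)) * (1 - c)" using assms by simp
    ultimately have "0 \<le> f (Suc (j - r)) - f (j - r)"
      by (meson zero_le_mult_iff not_le less_le_not_le)
    then show ?thesis using True by (simp add: W Suc_diff_le)
  next
    case False
    then show ?thesis using f0 by (simp add: W)
  qed
qed

text \<open>
  Darroch's theorem: the mode of a sum of independent \<open>0\<close>-\<open>1\<close> variables is less than one away from
  its mean. Each claim says that a difference of two coefficients, which is a linear
  functional of the generating function, is nonnegative. By the extremal principle only the shifted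
  binomial distributions with the same mean have to be examined.
\<close>

lemma pgf_mode:
  assumes "finite I" "\<And>i. i \<in> I \<Longrightarrow> 0 \<le> p i \<and> p i \<le> 1"
  shows "sum p I \<le> real j \<Longrightarrow> coeff (pgf p I) (Suc j) \<le> coeff (pgf p I) j"
    and "real (Suc j) \<le> sum p I \<Longrightarrow> coeff (pgf p I) j \<le> coeff (pgf p I) (Suc j)"
proof -
  show "coeff (pgf p I) (Suc j) \<le> coeff (pgf p I) j" if *: "sum p I \<le> real j"
  proof -
    obtain q c where "0 < c" "c < 1" "\<forall>i\<in>I. q i \<in> {0, c, 1}" "sum q I = sum p I"
      and le: "coeff (pgf q I) j - coeff (pgf q I) (Suc j)
        \<le> coeff (pgf p I) j - coeff (pgf p I) (Suc j)"
      using pgf_minimized_by_equal_interior[of I "\<lambda>P. coeff P j - coeff P (Suc j)" p] assms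
      by (auto simp: algebra_simps)
    then show ?thesis
      using three_values_mode(1)[of I q c j] * assms(1) by auto
  qed
  show "coeff (pgf p I) j \<le> coeff (pgf p I) (Suc j)" if *: "real (Suc j) \<le> sum p I"
  proof -
    obtain q c where "0 < c" "c < 1" "\<forall>i\<in>I. q i \<in> {0, c, 1}" "sum q I = sum p I"
      and le: "coeff (pgf q I) (Suc j) - coeff (pgf q I) j
        \<le> coeff (pgf p I) (Suc j) - coeff (pgf p I) j"
      using pgf_minimized_by_equal_interior[of I "\<lambda>P. coeff P (Suc j) - coeff P j" p] assms
      by (auto simp: algebra_simps)
    then show ?thesis
      using three_values_mode(2)[of I q c j] * assms(1) by auto
  qed
qed

section \<open>The score distribution in the linear model\<close>

lemma (in prob_space) AE_zero_one:
  fixes Y :: "'a \<Rightarrow> real"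
  assumes [measurable]: "random_variable borel Y"
    and "prob {\<omega> \<in> space M. Y \<omega> = 1} = p" and "prob {\<omega> \<in> space M. Y \<omega> = 0} = 1 - p"
  shows "AE \<omega> in M. Y \<omega> = 0 \<or> Y \<omega> = 1"
proof -
  have "prob ({\<omega> \<in> space M. Y \<omega> = 0} \<union> {\<omega> \<in> space M. Y \<omega> = 1}) = 1"
    using assms(2,3) by (subst finite_measure_Union) auto
  then have "AE \<omega> in M. \<omega> \<in> {\<omega> \<in> space M. Y \<omega> = 0} \<union> {\<omega> \<in> space M. Y \<omega> = 1}"
    by (rule AE_prob_1)
  then show ?thesis by eventually_elim auto
qed

lemma (in prob_space) AE_sum_zero_one_Nats:
  fixes Y :: "'i \<Rightarrow> 'a \<Rightarrow> real"
  assumes "finite I" and "\<And>i. i \<in> I \<Longrightarrow> random_variable borel (Y i)"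
    and "\<And>i. i \<in> I \<Longrightarrow> prob {\<omega> \<in> space M. Y i \<omega> = 1} = p i"
    and "\<And>i. i \<in> I \<Longrightarrow> prob {\<omega> \<in> space M. Y i \<omega> = 0} = 1 - p i"
  shows "AE \<omega> in M. (\<Sum>i\<in>I. Y i \<omega>) \<in> \<nat>"
proof -
  have "AE \<omega> in M. \<forall>i\<in>I. Y i \<omega> = 0 \<or> Y i \<omega> = 1"
  proof (rule AE_finite_allI[OF \<open>finite I\<close>])
    show "AE \<omega> in M. Y i \<omega> = 0 \<or> Y i \<omega> = 1" if "i \<in> I" for i
      using AE_zero_one[OF assms(2-4)[OF that]] .
  qed
  then show ?thesis
  proof eventually_elim
    case (elim \<omega>)
    with \<open>finite I\<close> show ?case by (induction I rule: finite_induct) auto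
  qed
qed

text \<open>
  Conditioning on one summand gives the recursion for multiplication by \<open>1 - p + p x\<close>. The variables
  take the values \<open>0\<close> and \<open>1\<close> only almost surely, hence the detour through null sets.
\<close>

lemma (in prob_space) prob_sum_zero_one_eq:
  fixes Y :: "'i \<Rightarrow> 'a \<Rightarrow> real"
  assumes "finite I" and "indep_vars (\<lambda>_. borel) Y I"
    and "\<And>i. i \<in> I \<Longrightarrow> prob {\<omega> \<in> space M. Y i \<omega> = 1} = p i"
    and "\<And>i. i \<in> I \<Longrightarrow> prob {\<omega> \<in> space M. Y i \<omega> = 0} = 1 - p i"
  shows "prob {\<omega> \<in> space M. (\<Sum>i\<in>I. Y i \<omega>) = real j} = coeff (pgf p I) j"
  using assms
proof (induction I arbitrary: j rule: finite_induct)
  case empty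
  then show ?case by (auto simp: pgf_def coeff_1 prob_space)
next
  case (insert i I)
  define S where "S \<omega> = (\<Sum>i\<in>I. Y i \<omega>)" for \<omega>
  have rv: "random_variable borel (Y l)" if "l \<in> insert i I" for l
    using insert.prems(1) that unfolding indep_vars_def by auto
  have [measurable]: "random_variable borel (Y i)" using rv by simp
  have [measurable]: "random_variable borel S"
    unfolding S_def using rv by (intro borel_measurable_sum) simp
  have indep: "indep_var borel (Y i) borel S"
    unfolding S_def using indep_vars_sum[OF insert.hyps insert.prems(1)] .
  have "indep_vars (\<lambda>_. borel) Y I"
    using insert.prems(1) by (rule indep_vars_subset) auto
  then have IH: "prob {\<omega> \<in> space M. S \<omega> = real l} = coeff (pgf p I) l" for l
    unfolding S_def using insert.IH insert.prems by simp
  have prod: "prob {\<omega> \<in> space M. Y i \<omega> = x \<and> S \<omega> = y}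
      = prob {\<omega> \<in> space M. Y i \<omega> = x} * prob {\<omega> \<in> space M. S \<omega> = y}" for x y
    using indep_varD[OF indep, of "{x}" "{y}"]
    by (simp add: vimage_def Int_def conj_commute)
  have AE: "AE \<omega> in M. Y i \<omega> = 0 \<or> Y i \<omega> = 1"
    using AE_zero_one[OF rv insert.prems(2,3)] by simp
  have "prob {\<omega> \<in> space M. (\<Sum>i\<in>insert i I. Y i \<omega>) = real j}
    = prob ({\<omega> \<in> space M. Y i \<omega> = 0 \<and> S \<omega> = real j}
        \<union> {\<omega> \<in> space M. Y i \<omega> = 1 \<and> S \<omega> = real j - 1})"
  proof (rule finite_measure_eq_AE)
    show "AE \<omega> in M. (\<omega> \<in> {\<omega> \<in> space M. (\<Sum>i\<in>insert i I. Y i \<omega>) = real j})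
      = (\<omega> \<in> {\<omega> \<in> space M. Y i \<omega> = 0 \<and> S \<omega> = real j}
        \<union> {\<omega> \<in> space M. Y i \<omega> = 1 \<and> S \<omega> = real j - 1})"
      using AE
    proof eventually_elim
      case (elim \<omega>)
      have "(\<Sum>i\<in>insert i I. Y i \<omega>) = Y i \<omega> + S \<omega>"
        using insert.hyps by (simp add: S_def)
      then show ?case using elim by auto
    qed
    have "(\<Sum>i\<in>insert i I. Y i \<omega>) = Y i \<omega> + S \<omega>" for \<omega>
      using insert.hyps by (simp add: S_def)
    then show "{\<omega> \<in> space M. (\<Sum>i\<in>insert i I. Y i \<omega>) = real j} \<in> events" by simp
  qed auto
  also have "\<dots> = (1 - p i) * coeff (pgf p I) j + p i * prob {\<omega> \<in> space M. S \<omega> = real j - 1}"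
    using insert.prems by (subst finite_measure_Union) (auto simp: prod IH)
  also have "prob {\<omega> \<in> space M. S \<omega> = real j - 1} = (if j = 0 then 0 else coeff (pgf p I) (j - 1))"
  proof (cases j)
    case 0
    have "AE \<omega> in M. S \<omega> \<in> \<nat>"
      unfolding S_def
      by (rule AE_sum_zero_one_Nats[where p = p]) (use insert.prems insert.hyps rv in simp_all)
    then have "AE \<omega> in M. S \<omega> \<noteq> -1" by eventually_elim (auto elim!: Nats_cases)
    then have "prob {\<omega> \<in> space M. S \<omega> = -1} = 0" by (subst prob_eq_0) (auto elim: eventually_mono)
    then show ?thesis using 0 by simp
  next
    case (Suc l)
    then show ?thesis using IH[of l] by simp
  qed
  also have "(1 - p i) * coeff (pgf p I) j + p i * (if j = 0 then 0 else coeff (pgf p I) (j - 1))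
      = coeff (pgf p (insert i I)) j"
    using insert.hyps by (cases j) (auto simp: pgf_def)
  finally show ?case .
qed

lemma (in prob_space) prob_sum_zero_one_ge:
  fixes Y :: "'i \<Rightarrow> 'a \<Rightarrow> real"
  assumes "finite I" and "indep_vars (\<lambda>_. borel) Y I"
    and "\<And>i. i \<in> I \<Longrightarrow> prob {\<omega> \<in> space M. Y i \<omega> = 1} = p i"
    and "\<And>i. i \<in> I \<Longrightarrow> prob {\<omega> \<in> space M. Y i \<omega> = 0} = 1 - p i"
  shows "prob {\<omega> \<in> space M. (\<Sum>i\<in>I. Y i \<omega>) \<ge> real k} = 1 - (\<Sum>j<k. coeff (pgf p I) j)"
proof -
  define S where "S \<omega> = (\<Sum>i\<in>I. Y i \<omega>)" for \<omega>
  have rv: "random_variable borel (Y l)" if "l \<in> I" for l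
    using assms(2) that unfolding indep_vars_def by auto
  then have [measurable]: "random_variable borel S"
    unfolding S_def by (intro borel_measurable_sum) simp
  have "AE \<omega> in M. S \<omega> \<in> \<nat>"
    unfolding S_def by (rule AE_sum_zero_one_Nats[where p = p]) (use assms rv in simp_all)
  then have "AE \<omega> in M. (\<omega> \<in> {\<omega> \<in> space M. \<not> S \<omega> \<ge> real k})
      = (\<omega> \<in> (\<Union>j<k. {\<omega> \<in> space M. S \<omega> = real j}))"
    by eventually_elim (auto elim!: Nats_cases)
  then have "prob {\<omega> \<in> space M. \<not> S \<omega> \<ge> real k} = prob (\<Union>j<k. {\<omega> \<in> space M. S \<omega> = real j})"
    by (rule finite_measure_eq_AE) auto
  also have "\<dots> = (\<Sum>j<k. prob {\<omega> \<in> space M. S \<omega> = real j})"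
    by (intro finite_measure_finite_Union) (auto simp: disjoint_family_on_def)
  also have "\<dots> = (\<Sum>j<k. coeff (pgf p I) j)"
    unfolding S_def using prob_sum_zero_one_eq[OF assms] by simp
  finally have "prob {\<omega> \<in> space M. \<not> S \<omega> \<ge> real k} = (\<Sum>j<k. coeff (pgf p I) j)" .
  moreover have "prob {\<omega> \<in> space M. \<not> S \<omega> \<ge> real k} = 1 - prob {\<omega> \<in> space M. S \<omega> \<ge> real k}"
    by (rule prob_neg) simp
  ultimately show ?thesis by (simp add: S_def)
qed

context linear_model
begin

definition match_prob :: "(nat \<Rightarrow> nat) \<Rightarrow> nat \<Rightarrow> real" where
  "match_prob \<sigma> i = win_prob \<alpha> (b (\<sigma> i) - a i)"

lemma match_prob_bounds:
  assumes "\<sigma> permutes {1..n}" "i \<in> {1..n}"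
  shows "0 < match_prob \<sigma> i" "match_prob \<sigma> i < 1"
proof -
  have "\<sigma> i \<in> {1..n}" using assms permutes_in_image by metis
  then show "0 < match_prob \<sigma> i" "match_prob \<sigma> i < 1"
    using differential_range[of i "\<sigma> i"] assms(2) alpha_pos
    by (auto simp: match_prob_def win_prob_def field_simps)
qed

lemma outcome_probs:
  assumes "\<sigma> permutes {1..n}" "i \<in> {1..n}"
  shows "prob {\<omega> \<in> space M. X (\<sigma> i) i \<omega> = 1} = match_prob \<sigma> i"
    and "prob {\<omega> \<in> space M. X (\<sigma> i) i \<omega> = 0} = 1 - match_prob \<sigma> i"
    and "random_variable borel (X (\<sigma> i) i)"
proof -
  have "\<sigma> i \<in> {1..n}" using assms permutes_in_image by metis
  then show "prob {\<omega> \<in> space M. X (\<sigma> i) i \<omega> = 1} = match_prob \<sigma> i"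
    "prob {\<omega> \<in> space M. X (\<sigma> i) i \<omega> = 0} = 1 - match_prob \<sigma> i"
    "random_variable borel (X (\<sigma> i) i)"
    using prob_win[OF assms(2)] prob_loss[OF assms(2)] points_measurable[OF assms(2)]
    by (auto simp: match_prob_def win_prob_def loss_prob_def)
qed

lemma score_prob_eq:
  assumes "\<sigma> permutes {1..n}"
  shows "score_prob M n X k \<sigma> = 1 - (\<Sum>j<k. coeff (pgf (match_prob \<sigma>) {1..n}) j)"
  unfolding score_prob_def total_score_def
  by (rule prob_sum_zero_one_ge[OF _ outcomes_indep[OF assms] outcome_probs(1,2)[OF assms]]) simp_all

lemma sum_match_prob:
  assumes "\<sigma> permutes {1..n}"
  shows "sum (match_prob \<sigma>) {1..n} = \<alpha> * (sum b {1..n} - sum a {1..n}) + real n / 2"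
proof -
  have "(\<Sum>i=1..n. b (\<sigma> i)) = sum b {1..n}"
    using sum.permute[OF assms, of b] by (simp add: comp_def)
  then show ?thesis
    by (simp add: match_prob_def win_prob_def sum.distrib sum_subtractf flip: sum_distrib_left)
qed

lemma expected_score_eq:
  assumes "\<sigma> permutes {1..n}"
  shows "expected_score M n X \<sigma> = sum (match_prob \<sigma>) {1..n}"
proof -
  have "has_bochner_integral M (X (\<sigma> i) i) (match_prob \<sigma> i)" if i: "i \<in> {1..n}" for i
  proof -
    let ?W = "{\<omega> \<in> space M. X (\<sigma> i) i \<omega> = 1}"
    note [measurable] = outcome_probs(3)[OF assms i]
    have "has_bochner_integral M (indicator ?W) (match_prob \<sigma> i)"
      using has_bochner_integral_real_indicator[of ?W M] outcome_probs(1)[OF assms i]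
      by (simp add: emeasure_eq_measure)
    moreover have "AE \<omega> in M. indicator ?W \<omega> = X (\<sigma> i) i \<omega>"
      using AE_zero_one[OF outcome_probs(3,1,2)[OF assms i]] AE_space
      by eventually_elim auto
    ultimately show ?thesis
      by (subst has_bochner_integral_cong_AE[symmetric]) auto
  qed
  then have "has_bochner_integral M (total_score n X \<sigma>) (sum (match_prob \<sigma>) {1..n})"
    unfolding total_score_def[abs_def] by (intro has_bochner_integral_sum) auto
  then show ?thesis
    unfolding expected_score_def by (rule has_bochner_integral_integral_eq)
qed

text \<open>
  Letting the opponents \<open>i\<close> and \<open>j\<close> trade their challengers changes the product of the two winning
  probabilities by \<open>\<alpha>\<^sup>2 (b (\<sigma> j) - b (\<sigma> i)) (a i - a j)\<close> and leaves their sum alone. Whether the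
  exchange pays therefore depends on the sign of one difference of point probabilities of the
  remaining matches.
\<close>

lemma score_prob_swap:
  assumes \<sigma>: "\<sigma> permutes {1..n}" and ij: "i \<in> {1..n}" "j \<in> {1..n}" "i \<noteq> j"
  shows "score_prob M n X (Suc m) (\<sigma> \<circ> Transposition.transpose i j) = score_prob M n X (Suc m) \<sigma>
    - \<alpha>\<^sup>2 * (b (\<sigma> j) - b (\<sigma> i)) * (a i - a j)
      * coeff ([:1, -1:] * pgf (match_prob \<sigma>) ({1..n} - {i, j})) m"
proof -
  let ?\<tau> = "\<sigma> \<circ> Transposition.transpose i j" and ?R = "[:1, -1:] * pgf (match_prob \<sigma>) ({1..n} - {i, j})"
  have \<tau>: "?\<tau> permutes {1..n}"
    using permutes_compose[OF permutes_swap_id[OF ij(1,2)] \<sigma>] .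
  have prod: "match_prob ?\<tau> i * match_prob ?\<tau> j - match_prob \<sigma> i * match_prob \<sigma> j
      = \<alpha>\<^sup>2 * (b (\<sigma> j) - b (\<sigma> i)) * (a i - a j)"
    by (simp add: match_prob_def win_prob_def algebra_simps power2_eq_square)
  have "pgf (match_prob ?\<tau>) {1..n} = pgf (match_prob \<sigma>) {1..n}
      + smult (match_prob ?\<tau> i * match_prob ?\<tau> j - match_prob \<sigma> i * match_prob \<sigma> j) ([:1, -1:] * ?R)"
    using ij by (intro pgf_pair_diff) (auto simp: match_prob_def win_prob_def algebra_simps)
  then have "(\<Sum>l<Suc m. coeff (pgf (match_prob ?\<tau>) {1..n}) l)
      = (\<Sum>l<Suc m. coeff (pgf (match_prob \<sigma>) {1..n}) l)
      + \<alpha>\<^sup>2 * (b (\<sigma> j) - b (\<sigma> i)) * (a i - a j) * (\<Sum>l<Suc m. coeff ([:1, -1:] * ?R) l)"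
    unfolding prod by (simp only: coeff_add coeff_smult sum.distrib flip: sum_distrib_left)
  then show ?thesis
    unfolding score_prob_eq[OF \<tau>] score_prob_eq[OF \<sigma>] sum_coeff_diff by simp
qed

end

section \<open>Sorting permutations by exchanges\<close>

text \<open>
  Putting the least non-fixed index \<open>i\<close> into place exchanges the entries at \<open>i\<close> and at the position of
  the value \<open>i\<close>; these form an inversion, and fewer points are moved afterwards.
\<close>

lemma permutation_sorting:
  fixes f :: "(nat \<Rightarrow> nat) \<Rightarrow> real"
  assumes swap: "\<And>\<sigma> i j. \<sigma> permutes {1..n} \<Longrightarrow> i \<in> {1..n} \<Longrightarrow> j \<in> {1..n} \<Longrightarrow> i < j \<Longrightarrow> \<sigma> j < \<sigma> i
      \<Longrightarrow> f \<sigma> \<le> f (\<sigma> \<circ> Transposition.transpose i j)"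
    and "\<sigma> permutes {1..n}"
  shows "f \<sigma> \<le> f id"
  using assms(2)
proof (induction "card {i \<in> {1..n}. \<sigma> i \<noteq> i}" arbitrary: \<sigma> rule: less_induct)
  case less
  note inj = permutes_inj[OF less.prems]
  show ?case
  proof (cases "\<sigma> = id")
    case False
    then have ex: "\<exists>i. \<sigma> i \<noteq> i" by auto
    define i where "i = (LEAST i. \<sigma> i \<noteq> i)"
    have i: "\<sigma> i \<noteq> i" unfolding i_def using ex by (rule LeastI_ex)
    have low: "\<sigma> l = l" if "l < i" for l using not_less_Least that unfolding i_def by blast
    obtain j where j: "\<sigma> j = i" using permutes_surj[OF less.prems] by (metis surjD)
    have I: "i \<in> {1..n}" "j \<in> {1..n}" using i j permutes_not_in[OF less.prems] by metis+
    have "i < \<sigma> i" using i low inj by (metis injD linorder_neqE_nat)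
    moreover have "i < j" using i j low by (metis linorder_neqE_nat)
    ultimately have "f \<sigma> \<le> f (\<sigma> \<circ> Transposition.transpose i j)" using swap[OF less.prems I] j by simp
    also have "\<dots> \<le> f id"
    proof (rule less.hyps)
      show "\<sigma> \<circ> Transposition.transpose i j permutes {1..n}"
        using permutes_compose[OF permutes_swap_id[OF I] less.prems] .
      have "{l \<in> {1..n}. (\<sigma> \<circ> Transposition.transpose i j) l \<noteq> l} \<subset> {l \<in> {1..n}. \<sigma> l \<noteq> l}"
        using i j I by (auto simp: Transposition.transpose_def)
      then show "card {l \<in> {1..n}. (\<sigma> \<circ> Transposition.transpose i j) l \<noteq> l} < card {l \<in> {1..n}. \<sigma> l \<noteq> l}"
        by (intro psubset_card_mono) auto
    qed
    finally show ?thesis .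
  qed simp
qed

lemma reverse_ordering_permutes: "reverse_ordering n permutes {1..n}"
  by (rule bij_imp_permutes, rule bij_betw_byWitness[where f' = "reverse_ordering n"])
     (auto simp: reverse_ordering_def)

text \<open>
  Reversing the values of a permutation turns its non-inversions into inversions.
\<close>

lemma permutation_reverse_sorting:
  fixes f :: "(nat \<Rightarrow> nat) \<Rightarrow> real"
  assumes swap: "\<And>\<sigma> i j. \<sigma> permutes {1..n} \<Longrightarrow> i \<in> {1..n} \<Longrightarrow> j \<in> {1..n} \<Longrightarrow> i < j \<Longrightarrow> \<sigma> i < \<sigma> j
      \<Longrightarrow> f \<sigma> \<le> f (\<sigma> \<circ> Transposition.transpose i j)"
    and \<sigma>: "\<sigma> permutes {1..n}"
  shows "f \<sigma> \<le> f (reverse_ordering n)"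
proof -
  let ?r = "reverse_ordering n"
  have inv: "?r (?r i) = i" for i by (auto simp: reverse_ordering_def)
  have "f (?r \<circ> (?r \<circ> \<sigma>)) \<le> f (?r \<circ> id)"
  proof (rule permutation_sorting[where f = "\<lambda>\<sigma>. f (?r \<circ> \<sigma>)" and n = n])
    fix \<rho> i j assume \<rho>: "\<rho> permutes {1..n}" and ij: "i \<in> {1..n}" "j \<in> {1..n}" "i < j" "\<rho> j < \<rho> i"
    have "\<rho> i \<in> {1..n}" "\<rho> j \<in> {1..n}" using \<rho> ij permutes_in_image by metis+
    then have "(?r \<circ> \<rho>) i < (?r \<circ> \<rho>) j" using ij by (auto simp: reverse_ordering_def)
    then have "f (?r \<circ> \<rho>) \<le> f ((?r \<circ> \<rho>) \<circ> Transposition.transpose i j)"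
      using swap permutes_compose[OF \<rho> reverse_ordering_permutes] ij by blast
    then show "f (?r \<circ> \<rho>) \<le> f (?r \<circ> (\<rho> \<circ> Transposition.transpose i j))" by (simp add: comp_assoc)
  next
    show "?r \<circ> \<sigma> permutes {1..n}" using permutes_compose[OF \<sigma> reverse_ordering_permutes] .
  qed
  then show ?thesis by (simp add: comp_def inv)
qed

section \<open>Optimal orderings away from the mean\<close>

context linear_model
begin

text \<open>
  The matches outside an exchanged pair have mean less than \<open>\<mu>\<close>, hence less than \<open>k - 2\<close>. By Darroch's
  theorem they yield \<open>k - 2\<close> points at least as likely as \<open>k - 1\<close>, so a larger product never hurts,
  and the product is larger when the stronger player meets the stronger opponent.
\<close>

lemma optimal_id:
  assumes \<mu>: "\<And>\<sigma>. \<sigma> permutes {1..n} \<Longrightarrow> expected_score M n X \<sigma> = \<mu>" and k: "real k \<ge> \<mu> + 2"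
  shows "optimal_ordering M n X k id"
  unfolding optimal_ordering_def
proof (intro conjI allI impI)
  show "id permutes {1..n}" by (rule permutes_id)
  fix \<tau> assume "\<tau> permutes {1..n}"
  then show "score_prob M n X k \<tau> \<le> score_prob M n X k id"
  proof (rule permutation_sorting[rotated])
    fix \<sigma> i j
    assume \<sigma>: "\<sigma> permutes {1..n}" and ij: "i \<in> {1..n}" "j \<in> {1..n}" "i < j" "\<sigma> j < \<sigma> i"
    define p where "p = match_prob \<sigma>"
    define J where "J = {1..n} - {i, j}"
    have p: "0 < p l \<and> p l < 1" if "l \<in> {1..n}" for l
      unfolding p_def using match_prob_bounds[OF \<sigma> that] by simp
    have sum: "sum p J + p i + p j = \<mu>"
      unfolding J_def
      using expected_score_eq[OF \<sigma>] \<mu>[OF \<sigma>] sum_remove_pair[of "{1..n}" i j p] ij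
      by (simp add: p_def)
    have "0 \<le> sum p J" by (intro sum_nonneg) (use p in \<open>auto simp: J_def less_imp_le\<close>)
    then have "real k > 2" using k sum p[OF ij(1)] p[OF ij(2)] by linarith
    then obtain m where m: "k = Suc (Suc m)" by (cases k; cases "k - 1") auto
    have "coeff (pgf p J) (Suc m) \<le> coeff (pgf p J) m"
      by (rule pgf_mode(1))
         (use p sum k m p[OF ij(1)] p[OF ij(2)] in \<open>auto simp: J_def less_imp_le\<close>)
    then have c: "coeff ([:1, -1:] * pgf p J) (Suc m) \<le> 0" by simp
    have "\<sigma> i \<in> {1..n}" "\<sigma> j \<in> {1..n}" using \<sigma> ij permutes_in_image by metis+
    then have "0 \<le> \<alpha>\<^sup>2 * (b (\<sigma> j) - b (\<sigma> i)) * (a i - a j)"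
      using monotone_onD[OF a_decreasing, of i j] monotone_onD[OF b_decreasing, of "\<sigma> j" "\<sigma> i"] ij
      by simp
    from mult_nonneg_nonpos[OF this c]
    show "score_prob M n X k \<sigma> \<le> score_prob M n X k (\<sigma> \<circ> Transposition.transpose i j)"
      using score_prob_swap[OF \<sigma> ij(1,2), of "Suc m"] ij by (simp only: m J_def p_def)
  qed
qed

text \<open>
  Here the remaining matches have mean greater than \<open>\<mu> - 2\<close>, hence greater than \<open>k - 1\<close>, so that \<open>k - 1\<close>
  points are at least as likely as \<open>k - 2\<close> and a smaller product never hurts.
\<close>

lemma optimal_reverse:
  assumes \<mu>: "\<And>\<sigma>. \<sigma> permutes {1..n} \<Longrightarrow> expected_score M n X \<sigma> = \<mu>" and k: "real k \<le> \<mu> - 1"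
  shows "optimal_ordering M n X k (reverse_ordering n)"
  unfolding optimal_ordering_def
proof (intro conjI allI impI)
  show "reverse_ordering n permutes {1..n}" by (rule reverse_ordering_permutes)
  fix \<tau> assume "\<tau> permutes {1..n}"
  then show "score_prob M n X k \<tau> \<le> score_prob M n X k (reverse_ordering n)"
  proof (rule permutation_reverse_sorting[rotated])
    fix \<sigma> i j
    assume \<sigma>: "\<sigma> permutes {1..n}" and ij: "i \<in> {1..n}" "j \<in> {1..n}" "i < j" "\<sigma> i < \<sigma> j"
    define p where "p = match_prob \<sigma>"
    define J where "J = {1..n} - {i, j}"
    have p: "0 < p l \<and> p l < 1" if "l \<in> {1..n}" for l
      unfolding p_def using match_prob_bounds[OF \<sigma> that] by simp
    have sum: "sum p J + p i + p j = \<mu>"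
      unfolding J_def
      using expected_score_eq[OF \<sigma>] \<mu>[OF \<sigma>] sum_remove_pair[of "{1..n}" i j p] ij
      by (simp add: p_def)
    have J: "finite J" "\<And>l. l \<in> J \<Longrightarrow> 0 \<le> p l \<and> p l \<le> 1"
      using p by (auto simp: J_def less_imp_le)
    show "score_prob M n X k \<sigma> \<le> score_prob M n X k (\<sigma> \<circ> Transposition.transpose i j)"
    proof (cases k)
      case 0
      then show ?thesis
        using score_prob_eq[OF \<sigma>] score_prob_eq[OF permutes_compose[OF permutes_swap_id[OF ij(1,2)] \<sigma>]]
        by simp
    next
      case (Suc m)
      have c: "0 \<le> coeff ([:1, -1:] * pgf p J) m"
      proof (cases m)
        case 0
        then show ?thesis using coeff_pgf_nonneg[OF J, where j = 0] by simp
      next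
        case (Suc l)
        have "coeff (pgf p J) l \<le> coeff (pgf p J) (Suc l)"
          by (rule pgf_mode(2)[OF J])
             (use sum k Suc \<open>k = Suc m\<close> p[OF ij(1)] p[OF ij(2)] in auto)
        then show ?thesis using Suc by simp
      qed
      have "\<sigma> i \<in> {1..n}" "\<sigma> j \<in> {1..n}" using \<sigma> ij permutes_in_image by metis+
      then have "\<alpha>\<^sup>2 * (b (\<sigma> j) - b (\<sigma> i)) * (a i - a j) \<le> 0"
        using monotone_onD[OF a_decreasing, of i j] monotone_onD[OF b_decreasing, of "\<sigma> i" "\<sigma> j"] ij
        by (intro mult_nonpos_nonneg mult_nonneg_nonpos) auto
      from mult_nonpos_nonneg[OF this c]
      show ?thesis
        using score_prob_swap[OF \<sigma> ij(1,2), of m] ij by (simp only: Suc J_def p_def)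
    qed
  qed
qed

end

section \<open>Matchups with conflicting optimal orderings\<close>

lemma binomial_coeff_diff_pos:
  fixes w :: real
  assumes "0 < w" "w < 1" "l \<le> N" "real (Suc l) < real (Suc N) * w"
  shows "0 < coeff ([:1, -1:] * [:1 - w, w:] ^ N) (Suc l)"
proof -
  have "0 < (real (Suc N) * w - real (Suc l)) * coeff ([:1 - w, w:] ^ N) l"
    using binomial_coeff_pos[OF assms(1-3)] assms(4) by (intro mult_pos_pos) auto
  also have "\<dots> = real (Suc l) * (1 - w) * (coeff ([:1 - w, w:] ^ N) (Suc l) - coeff ([:1 - w, w:] ^ N) l)"
    by (rule binomial_coeff_step[symmetric])
  finally have "0 < coeff ([:1 - w, w:] ^ N) (Suc l) - coeff ([:1 - w, w:] ^ N) l"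
    by (rule zero_less_mult_pos) (use assms in simp)
  then show ?thesis by simp
qed

lemma binomial_coeff_diff_neg:
  fixes w :: real
  assumes "0 < w" "w < 1" "l \<le> N" "real (Suc N) * w < real (Suc l)"
  shows "coeff ([:1, -1:] * [:1 - w, w:] ^ N) (Suc l) < 0"
proof -
  have "(real (Suc N) * w - real (Suc l)) * coeff ([:1 - w, w:] ^ N) l < 0"
    using binomial_coeff_pos[OF assms(1-3)] assms(4) by (intro mult_neg_pos) auto
  then have "real (Suc l) * (1 - w) * (coeff ([:1 - w, w:] ^ N) (Suc l) - coeff ([:1 - w, w:] ^ N) l) < 0"
    unfolding binomial_coeff_step .
  moreover have "0 < real (Suc l) * (1 - w)" using assms by simp
  ultimately have "coeff ([:1 - w, w:] ^ N) (Suc l) - coeff ([:1 - w, w:] ^ N) l < 0"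
    by (metis mult_less_0_iff order_less_asym)
  then show ?thesis by simp
qed

lemma (in prob_space) indep_vars_reindex:
  assumes "inj_on h I" and "indep_vars N Y (h ` I)"
  shows "indep_vars (\<lambda>i. N (h i)) (\<lambda>i. Y (h i)) I"
  unfolding indep_vars_def2 indep_sets_def
proof (intro conjI ballI allI impI)
  fix i assume "i \<in> I"
  then show "random_variable (N (h i)) (Y (h i))" using assms(2) by (auto simp: indep_vars_def)
  then show "{Y (h i) -` A \<inter> space M |A. A \<in> sets (N (h i))} \<subseteq> events"
    by (auto simp: measurable_def)
next
  fix J A
  assume J: "J \<subseteq> I" "J \<noteq> {}" "finite J"
    and A: "A \<in> (\<Pi> i\<in>J. {Y (h i) -` A \<inter> space M |A. A \<in> sets (N (h i))})"
  define B where "B = A \<circ> the_inv_into J h"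
  have inj: "inj_on h J" using assms(1) J(1) by (rule inj_on_subset)
  then have B: "B (h j) = A j" if "j \<in> J" for j
    using that by (simp add: B_def the_inv_into_f_f)
  have "B \<in> (\<Pi> l\<in>h ` J. {Y l -` A \<inter> space M |A. A \<in> sets (N l)})"
    using A B by (auto dest: Pi_mem)
  moreover have "h ` J \<subseteq> h ` I" "h ` J \<noteq> {}" "finite (h ` J)" using J by auto
  ultimately have "prob (\<Inter>j\<in>h ` J. B j) = (\<Prod>j\<in>h ` J. prob (B j))"
    using assms(2) unfolding indep_vars_def2 indep_sets_def by meson
  then show "prob (\<Inter>j\<in>J. A j) = (\<Prod>j\<in>J. prob (A j))"
    using B by (simp add: prod.reindex[OF inj])
qed

text \<open>
  All matches that could take place are decided by independent coins, of which an ordering reveals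
  \<open>n\<close>.
\<close>

definition outcome_space :: "nat \<Rightarrow> (nat \<Rightarrow> nat \<Rightarrow> real) \<Rightarrow> (nat \<times> nat \<Rightarrow> bool) measure" where
  "outcome_space n w = measure_pmf (Pi_pmf ({1..n} \<times> {1..n}) False (\<lambda>(j, i). bernoulli_pmf (w j i)))"

definition outcome :: "nat \<Rightarrow> nat \<Rightarrow> (nat \<times> nat \<Rightarrow> bool) \<Rightarrow> real" where
  "outcome j i \<omega> = of_bool (\<omega> (j, i))"

lemma linear_model_outcome_space:
  assumes "n \<ge> 1" "\<alpha> > 0" "antimono_on {1..n} a" "antimono_on {1..n} b"
    and range: "\<And>i j. i \<in> {1..n} \<Longrightarrow> j \<in> {1..n} \<Longrightarrow>
      0 < win_prob \<alpha> (b j - a i) \<and> win_prob \<alpha> (b j - a i) < 1"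
  shows "linear_model (outcome_space n (\<lambda>j i. win_prob \<alpha> (b j - a i))) n \<alpha> a b outcome"
proof -
  let ?w = "\<lambda>j i. win_prob \<alpha> (b j - a i)"
  let ?D = "{1..n} \<times> {1..n}"
  let ?p = "Pi_pmf ?D False (\<lambda>(j, i). bernoulli_pmf (?w j i))"
  have comp: "measure_pmf.prob ?p {\<omega>. \<omega> (j, i) = v} = pmf (bernoulli_pmf (?w j i)) v"
    if "i \<in> {1..n}" "j \<in> {1..n}" for i j v
  proof -
    have "measure_pmf.prob ?p {\<omega>. \<omega> (j, i) = v} = measure_pmf.prob (map_pmf (\<lambda>\<omega>. \<omega> (j, i)) ?p) {v}"
      by (simp add: vimage_def)
    also have "map_pmf (\<lambda>\<omega>. \<omega> (j, i)) ?p = bernoulli_pmf (?w j i)"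
      using that by (subst Pi_pmf_component) auto
    finally show ?thesis by (simp add: measure_pmf_single)
  qed
  interpret prob_space "outcome_space n ?w"
    unfolding outcome_space_def by (rule measure_pmf.prob_space_axioms)
  show ?thesis
  proof
    fix i j assume ij: "i \<in> {1..n}" "j \<in> {1..n}"
    have w: "0 < ?w j i" "?w j i < 1" using range[OF ij] by simp_all
    then show "b j - a i \<in> {- 1 / (2 * \<alpha>)<..<1 / (2 * \<alpha>)}"
      using \<open>\<alpha> > 0\<close> by (auto simp: win_prob_def field_simps)
    show "random_variable borel (outcome j i)" by (simp add: outcome_space_def)
    have "{\<omega> \<in> space (outcome_space n ?w). outcome j i \<omega> = 1} = {\<omega>. \<omega> (j, i) = True}"
      by (auto simp: outcome_space_def outcome_def)
    moreover have "{\<omega> \<in> space (outcome_space n ?w). outcome j i \<omega> = 0} = {\<omega>. \<omega> (j, i) = False}"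
      by (auto simp: outcome_space_def outcome_def)
    moreover have "measure (outcome_space n ?w) {\<omega>. \<omega> (j, i) = True} = ?w j i"
      unfolding outcome_space_def comp[OF ij] using w by simp
    moreover have "measure (outcome_space n ?w) {\<omega>. \<omega> (j, i) = False} = 1 - ?w j i"
      unfolding outcome_space_def comp[OF ij] using w by simp
    moreover have "loss_prob \<alpha> (b j - a i) = 1 - ?w j i"
      by (simp add: loss_prob_def win_prob_def)
    ultimately show "prob {\<omega> \<in> space (outcome_space n ?w). outcome j i \<omega> = 1} = ?w j i"
      and "prob {\<omega> \<in> space (outcome_space n ?w). outcome j i \<omega> = 0} = loss_prob \<alpha> (b j - a i)"
      by metis+
  next
    fix \<sigma> assume \<sigma>: "\<sigma> permutes {1..n}"
    let ?h = "\<lambda>i. (\<sigma> i, i)"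
    have "indep_vars (\<lambda>_. count_space UNIV) (\<lambda>x \<omega>. \<omega> x) ?D"
      unfolding outcome_space_def by (rule indep_vars_Pi_pmf) simp
    moreover have "?h ` {1..n} \<subseteq> ?D"
    proof (rule image_subsetI)
      fix i assume "i \<in> {1..n}"
      moreover from this have "\<sigma> i \<in> {1..n}" using permutes_in_image[OF \<sigma>] by blast
      ultimately show "?h i \<in> ?D" by (rule SigmaI[rotated])
    qed
    ultimately have "indep_vars (\<lambda>_. count_space UNIV) (\<lambda>x \<omega>. \<omega> x) (?h ` {1..n})"
      by (rule indep_vars_subset)
    then have "indep_vars (\<lambda>_. count_space UNIV) (\<lambda>i \<omega>. \<omega> (?h i)) {1..n}"
      by (intro indep_vars_reindex[where h = ?h and N = "\<lambda>_. count_space UNIV" and Y = "\<lambda>x \<omega>. \<omega> x"])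
        (simp add: inj_on_def)
    then have "indep_vars (\<lambda>_. borel) (\<lambda>i \<omega>. of_bool (\<omega> (?h i)) :: real) {1..n}"
      by (rule indep_vars_compose2[where Y = "\<lambda>_. of_bool"]) simp
    then show "indep_vars (\<lambda>_. borel) (\<lambda>i. outcome (\<sigma> i) i) {1..n}"
      by (simp add: outcome_def[abs_def])
  qed (fact assms(1-4))+
qed

text \<open>
  When all opponents but the weakest are equally strong, an ordering matters only through the player
  \<open>\<sigma> n\<close> who meets the weakest one. Handing this opponent to player \<open>j\<close> instead changes the score
  probability by a positive multiple of the quantity assumed to be positive in \<open>gain\<close>.
\<close>

lemma (in linear_model) not_optimal_by_weak_opponent:
  assumes \<sigma>: "\<sigma> permutes {1..n}"
    and a: "\<And>i. i \<in> {1..n} - {n} \<Longrightarrow> a i = A" "a n < A"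
    and j: "j \<in> {1..n}" "j \<noteq> \<sigma> n"
    and gain: "(b j - b (\<sigma> n))
      * coeff ([:1, -1:] * pgf (\<lambda>l. win_prob \<alpha> (b l - A)) ({1..n} - {j, \<sigma> n})) m > 0"
  shows "\<not> optimal_ordering M n X (Suc m) \<sigma>"
proof
  assume opt: "optimal_ordering M n X (Suc m) \<sigma>"
  obtain i where i: "\<sigma> i = j" using permutes_surj[OF \<sigma>] by (metis surjD)
  have I: "i \<in> {1..n}" "n \<in> {1..n}" "i \<noteq> n"
    using i j permutes_in_image[OF \<sigma>, of i] n_ge_1 by auto
  have inj: "inj_on \<sigma> K" for K using permutes_inj[OF \<sigma>] by (rule inj_on_subset) simp
  have "\<sigma> ` ({1..n} - {i, n}) = \<sigma> ` {1..n} - \<sigma> ` {i, n}"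
    using permutes_inj[OF \<sigma>] by (rule image_set_diff)
  then have "{1..n} - {j, \<sigma> n} = \<sigma> ` ({1..n} - {i, n})"
    using permutes_image[OF \<sigma>] i by simp
  then have "pgf (\<lambda>l. win_prob \<alpha> (b l - A)) ({1..n} - {j, \<sigma> n})
      = pgf (match_prob \<sigma>) ({1..n} - {i, n})"
    unfolding pgf_def using a by (simp add: prod.reindex[OF inj] match_prob_def)
  moreover have "0 < \<alpha>\<^sup>2 * (A - a n)" using alpha_pos a(2) by simp
  ultimately have "0 < \<alpha>\<^sup>2 * (A - a n) * ((b j - b (\<sigma> n))
      * coeff ([:1, -1:] * pgf (match_prob \<sigma>) ({1..n} - {i, n})) m)"
    using gain mult_pos_pos by metis
  then have "score_prob M n X (Suc m) \<sigma> < score_prob M n X (Suc m) (\<sigma> \<circ> Transposition.transpose i n)"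
    using score_prob_swap[OF \<sigma> I, of m] i a(1)[of i] I
    by (simp add: algebra_simps del: mult_pCons_left)
  moreover have "\<sigma> \<circ> Transposition.transpose i n permutes {1..n}"
    using permutes_compose[OF permutes_swap_id[OF I(1,2)] \<sigma>] .
  ultimately show False using opt unfolding optimal_ordering_def by (meson not_le)
qed

text \<open>
  The offset \<open>d\<close> is \<open>k - \<mu>\<close>. Two matchups that disagree show that \<open>n\<close>, \<open>k\<close> and \<open>\<mu>\<close> do not determine
  which ordering is best.
\<close>

definition conflict_at_offset :: "real \<Rightarrow> real \<Rightarrow> bool" where
  "conflict_at_offset \<alpha> d \<longleftrightarrow>
     (\<exists>n k \<mu> a b a' b'
         (M :: (nat \<times> nat \<Rightarrow> bool) measure) X
         (M' :: (nat \<times> nat \<Rightarrow> bool) measure) X'.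
       k \<le> n \<and> real k = \<mu> + d \<and>
       linear_model M n \<alpha> a b X \<and>
       (\<forall>\<sigma>. \<sigma> permutes {1..n} \<longrightarrow> expected_score M n X \<sigma> = \<mu>) \<and>
       linear_model M' n \<alpha> a' b' X' \<and>
       (\<forall>\<sigma>. \<sigma> permutes {1..n} \<longrightarrow> expected_score M' n X' \<sigma> = \<mu>) \<and>
       \<not> (\<exists>\<sigma>. optimal_ordering M n X k \<sigma> \<and> optimal_ordering M' n X' k \<sigma>))"

text \<open>
  A team is described by the probabilities \<open>\<beta> j\<close> of beating a regular opponent; the weakest
  opponent is beaten with probability \<open>\<beta> j + u\<close>. In the first matchup every optimal ordering sends
  \<open>j0\<close> against the weakest opponent, in the second matchup \<open>j1\<close> is a better choice than \<open>j0\<close>.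
\<close>

lemma conflicting_models:
  fixes \<beta> \<beta>' :: "nat \<Rightarrow> real"
  assumes "\<alpha> > 0" "Suc m \<le> n" "0 < u"
    and mono: "antimono_on {1..n} \<beta>" "antimono_on {1..n} \<beta>'"
    and range: "\<And>i. i \<in> {1..n} \<Longrightarrow> 0 < \<beta> i \<and> \<beta> i < 1 - u"
      "\<And>i. i \<in> {1..n} \<Longrightarrow> 0 < \<beta>' i \<and> \<beta>' i < 1 - u"
    and sum: "sum \<beta> {1..n} + u = real (Suc m) - d" "sum \<beta>' {1..n} + u = real (Suc m) - d"
    and j0: "j0 \<in> {1..n}"
    and best: "\<And>j. j \<in> {1..n} \<Longrightarrow> j \<noteq> j0 \<Longrightarrow>
      (\<beta> j0 - \<beta> j) * coeff ([:1, -1:] * pgf \<beta> ({1..n} - {j0, j})) m > 0"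
    and j1: "j1 \<in> {1..n}" "j1 \<noteq> j0"
    and better: "(\<beta>' j1 - \<beta>' j0) * coeff ([:1, -1:] * pgf \<beta>' ({1..n} - {j1, j0})) m > 0"
  shows "conflict_at_offset \<alpha> d"
proof -
  define a where "a i = (if i = n then - u / \<alpha> else 0)" for i :: nat
  define str where "str \<gamma> j = (\<gamma> j - 1 / 2) / \<alpha>" for \<gamma> :: "nat \<Rightarrow> real" and j
  define N where "N \<gamma> = outcome_space n (\<lambda>j i. win_prob \<alpha> (str \<gamma> j - a i))" for \<gamma>
  have n: "n \<in> {1..n}" using assms(2) by simp
  have win: "win_prob \<alpha> (str \<gamma> j - a i) = \<gamma> j + (if i = n then u else 0)" for \<gamma> j i
    using \<open>\<alpha> > 0\<close> by (simp add: win_prob_def str_def a_def field_simps)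
  have win0: "win_prob \<alpha> (str \<gamma> j - 0) = \<gamma> j" for \<gamma> j
    using \<open>\<alpha> > 0\<close> by (simp add: win_prob_def str_def)
  have antimono_a: "antimono_on {1..n} a"
    using \<open>0 < u\<close> \<open>\<alpha> > 0\<close> by (intro monotone_onI) (auto simp: a_def)
  have model: "linear_model (N \<gamma>) n \<alpha> a (str \<gamma>) outcome"
    if mono: "antimono_on {1..n} \<gamma>" and \<gamma>: "\<And>i. i \<in> {1..n} \<Longrightarrow> 0 < \<gamma> i \<and> \<gamma> i < 1 - u" for \<gamma>
    unfolding N_def
  proof (rule linear_model_outcome_space)
    show "antimono_on {1..n} (str \<gamma>)"
      using monotone_onD[OF mono] \<open>\<alpha> > 0\<close>
      by (intro monotone_onI) (auto simp: str_def divide_right_mono)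
    show "0 < win_prob \<alpha> (str \<gamma> j - a i) \<and> win_prob \<alpha> (str \<gamma> j - a i) < 1"
      if "i \<in> {1..n}" "j \<in> {1..n}" for i j
      unfolding win using \<gamma>[OF that(2)] \<open>0 < u\<close> by simp
  qed (use assms antimono_a in auto)
  interpret A: linear_model "N \<beta>" n \<alpha> a "str \<beta>" outcome by (rule model[OF mono(1) range(1)])
  interpret B: linear_model "N \<beta>'" n \<alpha> a "str \<beta>'" outcome by (rule model[OF mono(2) range(2)])
  have total: "\<alpha> * (sum (str \<gamma>) {1..n} - sum a {1..n}) + real n / 2 = sum \<gamma> {1..n} + u" for \<gamma>
  proof -
    have "\<alpha> * sum (str \<gamma>) {1..n} = sum \<gamma> {1..n} - real n / 2"
      using \<open>\<alpha> > 0\<close> by (simp add: str_def sum_distrib_left sum_subtractf)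
    moreover have "\<alpha> * sum a {1..n} = - u"
      using \<open>\<alpha> > 0\<close> n by (simp add: a_def)
    ultimately show ?thesis by (simp add: right_diff_distrib)
  qed
  have disj: "\<not> (optimal_ordering (N \<beta>) n outcome (Suc m) \<sigma> \<and> optimal_ordering (N \<beta>') n outcome (Suc m) \<sigma>)"
    for \<sigma>
  proof
    assume opt: "optimal_ordering (N \<beta>) n outcome (Suc m) \<sigma> \<and> optimal_ordering (N \<beta>') n outcome (Suc m) \<sigma>"
    then have \<sigma>: "\<sigma> permutes {1..n}" unfolding optimal_ordering_def by simp
    have weak: "a i = 0" if "i \<in> {1..n} - {n}" for i using that by (simp add: a_def)
    have weakn: "a n < 0" using \<open>0 < u\<close> \<open>\<alpha> > 0\<close> by (simp add: a_def)
    have scale: "0 < (str \<gamma> i - str \<gamma> j) * c" if "0 < (\<gamma> i - \<gamma> j) * c" for \<gamma> i j c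
    proof -
      have "(str \<gamma> i - str \<gamma> j) * c = ((\<gamma> i - \<gamma> j) * c) / \<alpha>"
        by (simp add: str_def diff_divide_distrib[symmetric])
      then show ?thesis using that \<open>\<alpha> > 0\<close> by simp
    qed
    have "\<sigma> n = j0"
    proof (rule ccontr)
      assume "\<sigma> n \<noteq> j0"
      moreover have "\<sigma> n \<in> {1..n}" using permutes_in_image[OF \<sigma>] n by simp
      ultimately have "\<not> optimal_ordering (N \<beta>) n outcome (Suc m) \<sigma>"
        by (intro A.not_optimal_by_weak_opponent[OF \<sigma> weak weakn j0] scale; simp only: win0)
           (use best[of "\<sigma> n"] in auto)
      then show False using opt by simp
    qed
    then have "\<not> optimal_ordering (N \<beta>') n outcome (Suc m) \<sigma>"
      using j1 better
      by (intro B.not_optimal_by_weak_opponent[OF \<sigma> weak weakn j1(1)] scale; simp only: win0)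
    then show False using opt by simp
  qed
  show ?thesis
    unfolding conflict_at_offset_def
  proof (intro exI conjI)
    show "real (Suc m) = (real (Suc m) - d) + d" by simp
    show "\<forall>\<sigma>. \<sigma> permutes {1..n} \<longrightarrow> expected_score (N \<beta>) n outcome \<sigma> = real (Suc m) - d"
      using A.expected_score_eq A.sum_match_prob total sum by simp
    show "\<forall>\<sigma>. \<sigma> permutes {1..n} \<longrightarrow> expected_score (N \<beta>') n outcome \<sigma> = real (Suc m) - d"
      using B.expected_score_eq B.sum_match_prob total sum by simp
    show "\<not> (\<exists>\<sigma>. optimal_ordering (N \<beta>) n outcome (Suc m) \<sigma> \<and> optimal_ordering (N \<beta>') n outcome (Suc m) \<sigma>)"
      using disj by blast
  qed (fact A.linear_model_axioms B.linear_model_axioms assms(2))+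
qed

text \<open>
  Numbers for two teams with the same mean. The first team has one player with probability \<open>x\<close> and
  \<open>n - 1\<close> players with probability \<open>y\<close>, the second has players with probabilities \<open>x'\<close> and \<open>z\<close> and
  \<open>n - 2\<close> players with probability \<open>e\<close>. In the first team the best player is compared with a regular one,
  in the second team with the second best. Either way the remaining players score according to a
  binomial distribution with \<open>n - 2\<close> trials, for which one point is more likely than none if and only if \<open>n - 1\<close> times the success probability exceeds \<open>1\<close>; the two teams
  are on different sides of this threshold. Since \<open>y\<close> and \<open>e\<close> are of order \<open>1 / n\<close>, the mean forces
  \<open>(n - 1) y \<longlonglongrightarrow> 2 - d - x\<close> and \<open>(n - 1) e \<longlonglongrightarrow> 2 - d - (x' + z)\<close>, so that \<open>x < 1 - d\<close> and
  \<open>1 - d < x' + z < 2 - d\<close> are what is needed. The first forces \<open>d < 1\<close>, the second \<open>d > -1\<close>. The number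
  \<open>\<epsilon>\<close> is \<open>-1\<close> or \<open>1\<close> in the applications and compensates the advantage \<open>u\<close> against the weakest
  opponent.
\<close>

lemma conflicting_profile_parameters:
  fixes d \<epsilon> :: real
  assumes "-1 < d" "d < 1"
  shows "\<exists>(n::nat) u x y x' z e. 3 \<le> n \<and> 0 < u
    \<and> u < y \<and> y < x \<and> x < 1 - u \<and> x + real (n - 1) * y = 2 - d + \<epsilon> * u \<and> 1 < real (n - 1) * y
    \<and> u < e \<and> e < z \<and> z < x' \<and> x' < 1 - u \<and> x' + z + real (n - 2) * e = 2 - d + \<epsilon> * u
    \<and> real (n - 1) * e < 1"
proof -
  \<comment> \<open>With \<open>x' = 1 - h\<close> and \<open>z = 1 - 3 * h\<close> the sum \<open>x' + z = (3 - d) / 2\<close> is the midpoint of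
    \<open>1 - d\<close> and \<open>2\<close>, which is below \<open>2 - d\<close> because \<open>d < 1\<close>. The advantage \<open>u\<close> is of order \<open>1 / n^2\<close> to be negligible against \<open>y\<close> and \<open>e\<close>.\<close>
  define h where "h = (1 + d) / 8"
  have h: "0 < h" "h < 1 / 4" and d: "d = 8 * h - 1" using assms by (auto simp: h_def field_simps)
  define x where "x = (2 - 8 * h) / 3"
  define c where "c = (7 - 16 * h) / 3"
  define u where "u n = 1 / real n ^ 2" for n :: nat
  define y where "y n = (c + \<epsilon> * u n) / (real n - 1)" for n :: nat
  define e where "e n = (1 - 4 * h + \<epsilon> * u n) / (real n - 2)" for n :: nat
  have u0: "u \<longlonglongrightarrow> 0" and y0: "y \<longlonglongrightarrow> 0" and e0: "e \<longlonglongrightarrow> 0"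
    unfolding u_def y_def e_def by real_asymp+
  have nu: "(\<lambda>n. real n * u n) \<longlonglongrightarrow> 0"
    and ny: "(\<lambda>n. real n * y n) \<longlonglongrightarrow> c" "(\<lambda>n. (real n - 1) * y n) \<longlonglongrightarrow> c"
    and ne: "(\<lambda>n. real n * e n) \<longlonglongrightarrow> 1 - 4 * h" "(\<lambda>n. (real n - 1) * e n) \<longlonglongrightarrow> 1 - 4 * h"
    unfolding u_def y_def e_def by real_asymp+
  have xc: "0 < x" "x < 1" "1 < c" using h by (auto simp: x_def c_def)
  define t where "t = (1 - 4 * h) / 2"
  have t: "0 < t" "t < 1 - 4 * h" "t < c" using h xc(3) by (auto simp: t_def)
  have "\<forall>\<^sub>F n in sequentially. u n < 1 - x" by (rule order_tendstoD(2)[OF u0]) (use xc in simp)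
  moreover have "\<forall>\<^sub>F n in sequentially. u n < h" by (rule order_tendstoD(2)[OF u0 h(1)])
  moreover have "\<forall>\<^sub>F n in sequentially. y n < x" by (rule order_tendstoD(2)[OF y0 xc(1)])
  moreover have "\<forall>\<^sub>F n in sequentially. e n < 1 - 3 * h" by (rule order_tendstoD(2)[OF e0]) (use h in simp)
  moreover have "\<forall>\<^sub>F n in sequentially. real n * u n < t" by (rule order_tendstoD(2)[OF nu t(1)])
  moreover have "\<forall>\<^sub>F n in sequentially. t < real n * y n" by (rule order_tendstoD(1)[OF ny(1) t(3)])
  moreover have "\<forall>\<^sub>F n in sequentially. t < real n * e n" by (rule order_tendstoD(1)[OF ne(1) t(2)])
  moreover have "\<forall>\<^sub>F n in sequentially. 1 < (real n - 1) * y n" by (rule order_tendstoD(1)[OF ny(2) xc(3)])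
  moreover have "\<forall>\<^sub>F n in sequentially. (real n - 1) * e n < 1"
    by (rule order_tendstoD(2)[OF ne(2)]) (use h in simp)
  moreover have "\<forall>\<^sub>F n in sequentially. 3 \<le> n" by (rule eventually_ge_at_top)
  ultimately have "\<forall>\<^sub>F n in sequentially. 3 \<le> n \<and> u n < 1 - x \<and> u n < h \<and> y n < x \<and> e n < 1 - 3 * h
      \<and> real n * u n < t \<and> t < real n * y n \<and> t < real n * e n
      \<and> 1 < (real n - 1) * y n \<and> (real n - 1) * e n < 1"
    by eventually_elim (intro conjI)
  then obtain n where n: "3 \<le> n" "u n < 1 - x" "u n < h" "y n < x" "e n < 1 - 3 * h"
      "real n * u n < t" "t < real n * y n" "t < real n * e n"
      "1 < (real n - 1) * y n" "(real n - 1) * e n < 1"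
    using eventually_happens'[OF sequentially_bot] by blast
  have "real n * u n < real n * y n" "real n * u n < real n * e n" 
    using less_trans[OF n(6,7)] less_trans[OF n(6,8)] by blast+
  then have small: "u n < y n" "u n < e n" using n(1) by simp_all
  have upos: "0 < u n" using n(1) by (simp add: u_def)
  have real_n: "real (n - 1) = real n - 1" "real (n - 2) = real n - 2" using n(1) by auto
  have "real (n - 1) * y n = c + \<epsilon> * u n" "real (n - 2) * e n = 1 - 4 * h + \<epsilon> * u n"
    unfolding real_n using n(1) by (simp_all add: y_def e_def)
  then have sums: "x + real (n - 1) * y n = 2 - d + \<epsilon> * u n"
    "(1 - h) + (1 - 3 * h) + real (n - 2) * e n = 2 - d + \<epsilon> * u n"
    by (simp_all add: d x_def c_def field_simps)
  have "x < 1 - u n" "1 - h < 1 - u n" "1 - 3 * h < 1 - h" using n(2,3) h(1) by linarith+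
  with n(1,4,5) n(9,10)[folded real_n] small upos sums show ?thesis by blast
qed

text \<open>
  Here \<open>k = 2\<close>. In the first team the best player must meet the weakest opponent, in the second team
  the second best player is preferable to the best one.
\<close>

lemma conflicting_models_small:
  assumes "\<alpha> > 0" "-1 < d" "d < 1"
  shows "conflict_at_offset \<alpha> d"
proof -
  obtain n u x y x' z e where P: "3 \<le> n" "0 < u" "u < y" "y < x" "x < 1 - u"
      "x + real (n - 1) * y = 2 - d + (-1) * u" "1 < real (n - 1) * y"
      "u < e" "e < z" "z < x'" "x' < 1 - u" "x' + z + real (n - 2) * e = 2 - d + (-1) * u"
      "real (n - 1) * e < 1"
    using conflicting_profile_parameters[OF assms(2,3), of "-1"] by blast
  define \<beta> where "\<beta> i = (if i = 1 then x else y)" for i :: nat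
  define \<beta>' where "\<beta>' i = (if i = 1 then x' else if i = 2 then z else e)" for i :: nat
  have N: "real (Suc (n - 2)) = real (n - 1)" using P(1) by simp
  have card: "card ({1..n} - {i, j}) = n - 2" if "i \<in> {1..n}" "j \<in> {1..n}" "i \<noteq> j" for i j
    using that by (subst card_Diff_subset) auto
  show ?thesis
  proof (rule conflicting_models[where m = "Suc 0" and n = n and u = u and \<beta> = \<beta> and \<beta>' = \<beta>'
        and ?j0.0 = 1 and ?j1.0 = 2])
    have "sum \<beta> {1..n} = x + sum \<beta> ({1..n} - {1})"
      using P(1) by (subst sum.remove[of _ 1]) (auto simp: \<beta>_def)
    also have "sum \<beta> ({1..n} - {1}) = real (n - 1) * y"
      using P(1) by (subst sum.cong[where h = "\<lambda>_. y", OF refl]) (auto simp: \<beta>_def card_Diff_singleton)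
    finally show "sum \<beta> {1..n} + u = real (Suc (Suc 0)) - d" using P by simp
    have "sum \<beta>' {1..n} = x' + z + sum \<beta>' ({1..n} - {1, 2})"
      using P(1) by (subst sum_remove_pair[of _ 1 2]) (auto simp: \<beta>'_def)
    also have "sum \<beta>' ({1..n} - {1, 2}) = real (n - 2) * e"
      using card[of 1 2] P(1) by (subst sum.cong[where h = "\<lambda>_. e", OF refl]) (auto simp: \<beta>'_def)
    finally show "sum \<beta>' {1..n} + u = real (Suc (Suc 0)) - d" using P by simp
    show "(\<beta> 1 - \<beta> j) * coeff ([:1, -1:] * pgf \<beta> ({1..n} - {1, j})) (Suc 0) > 0"
      if "j \<in> {1..n}" "j \<noteq> 1" for j
    proof -
      have "pgf \<beta> ({1..n} - {1, j}) = (\<Prod>i\<in>{1..n} - {1, j}. [:1 - y, y:])"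
        unfolding pgf_def by (rule prod.cong) (auto simp: \<beta>_def)
      also have "\<dots> = [:1 - y, y:] ^ (n - 2)" using card[of 1 j] that P(1) by simp
      finally show ?thesis
        using binomial_coeff_diff_pos[of y 0 "n - 2"] P that unfolding N by (simp add: \<beta>_def)
    qed
    have "pgf \<beta>' ({1..n} - {2, 1}) = (\<Prod>i\<in>{1..n} - {2, 1}. [:1 - e, e:])"
      unfolding pgf_def by (rule prod.cong) (auto simp: \<beta>'_def)
    also have "\<dots> = [:1 - e, e:] ^ (n - 2)" using card[of 2 1] P(1) by simp
    finally show "(\<beta>' 2 - \<beta>' 1) * coeff ([:1, -1:] * pgf \<beta>' ({1..n} - {2, 1})) (Suc 0) > 0"
      using binomial_coeff_diff_neg[of e 0 "n - 2"] P unfolding N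
      by (intro mult_neg_neg) (auto simp: \<beta>'_def)
  qed (use P assms in \<open>auto simp: \<beta>_def \<beta>'_def intro!: monotone_onI\<close>)
qed

text \<open>
  Interchanging wins and losses turns \<open>k\<close> into \<open>n + 1 - k\<close> and \<open>d\<close> into \<open>1 - d\<close>. So the teams of the
  case \<open>k = 2\<close> with offset \<open>1 - d\<close>, complemented and listed in reverse, serve for \<open>k = n - 1\<close> and
  offset \<open>d\<close>.
\<close>

lemma conflicting_models_large:
  assumes "\<alpha> > 0" "0 < d" "d < 2"
  shows "conflict_at_offset \<alpha> d"
proof -
  obtain n u x y x' z e where P: "3 \<le> n" "0 < u" "u < y" "y < x" "x < 1 - u"
      "x + real (n - 1) * y = 2 - (1 - d) + 1 * u" "1 < real (n - 1) * y"
      "u < e" "e < z" "z < x'" "x' < 1 - u" "x' + z + real (n - 2) * e = 2 - (1 - d) + 1 * u"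
      "real (n - 1) * e < 1"
    using conflicting_profile_parameters[of "1 - d" 1] assms by auto
  define \<beta> where "\<beta> i = (if i = n then 1 - x else 1 - y)" for i :: nat
  define \<beta>' where "\<beta>' i = (if i = n then 1 - x' else if i = n - 1 then 1 - z else 1 - e)" for i :: nat
  obtain m where m: "n = Suc (Suc (Suc m))"
    using P(1) by (cases n; cases "n - 1"; cases "n - 2") auto
  have card: "card ({1..n} - {i, j}) = Suc m" if "i \<in> {1..n}" "j \<in> {1..n}" "i \<noteq> j" for i j
    using that by (subst card_Diff_subset) (auto simp: m)
  have N: "real (Suc (Suc m)) * (1 - t) = real (Suc m) + (1 - real (n - 1) * t)" for t
    by (simp add: m algebra_simps)
  show ?thesis
  proof (rule conflicting_models[where m = "Suc m" and n = n and u = u and \<beta> = \<beta> and \<beta>' = \<beta>'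
        and ?j0.0 = n and ?j1.0 = "n - 1"])
    have "sum \<beta> {1..n} = 1 - x + sum \<beta> ({1..n} - {n})"
      using P(1) by (subst sum.remove[of _ n]) (auto simp: \<beta>_def)
    also have "sum \<beta> ({1..n} - {n}) = real (n - 1) * (1 - y)"
      using P(1) by (subst sum.cong[where h = "\<lambda>_. 1 - y", OF refl]) (auto simp: \<beta>_def)
    finally show "sum \<beta> {1..n} + u = real (Suc (Suc m)) - d" using P by (simp add: m algebra_simps)
    have "sum \<beta>' {1..n} = 1 - x' + (1 - z) + sum \<beta>' ({1..n} - {n, n - 1})"
      using P(1) by (subst sum_remove_pair[of _ n "n - 1"]) (auto simp: \<beta>'_def)
    also have "sum \<beta>' ({1..n} - {n, n - 1}) = real (n - 2) * (1 - e)"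
      using card[of n "n - 1"] by (subst sum.cong[where h = "\<lambda>_. 1 - e", OF refl]) (auto simp: \<beta>'_def m)
    finally show "sum \<beta>' {1..n} + u = real (Suc (Suc m)) - d" using P by (simp add: m algebra_simps)
    show "(\<beta> n - \<beta> j) * coeff ([:1, -1:] * pgf \<beta> ({1..n} - {n, j})) (Suc m) > 0"
      if "j \<in> {1..n}" "j \<noteq> n" for j
    proof -
      have "pgf \<beta> ({1..n} - {n, j}) = (\<Prod>i\<in>{1..n} - {n, j}. [:1 - (1 - y), 1 - y:])"
        unfolding pgf_def by (rule prod.cong) (auto simp: \<beta>_def)
      also have "\<dots> = [:1 - (1 - y), 1 - y:] ^ Suc m"
        using card[of n j] that by (simp only: prod_constant) auto
      finally have R: "pgf \<beta> ({1..n} - {n, j}) = [:1 - (1 - y), 1 - y:] ^ Suc m" .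
      have "coeff ([:1, -1:] * pgf \<beta> ({1..n} - {n, j})) (Suc m) < 0"
        unfolding R by (rule binomial_coeff_diff_neg, unfold N) (use P in auto)
      then show ?thesis using that P by (intro mult_neg_neg) (auto simp: \<beta>_def)
    qed
    have "pgf \<beta>' ({1..n} - {n - 1, n}) = (\<Prod>i\<in>{1..n} - {n - 1, n}. [:1 - (1 - e), 1 - e:])"
      unfolding pgf_def by (rule prod.cong) (auto simp: \<beta>'_def)
    also have "\<dots> = [:1 - (1 - e), 1 - e:] ^ Suc m"
      using card[of "n - 1" n] m by (simp only: prod_constant) auto
    finally have R: "pgf \<beta>' ({1..n} - {n - 1, n}) = [:1 - (1 - e), 1 - e:] ^ Suc m" .
    have "0 < coeff ([:1, -1:] * pgf \<beta>' ({1..n} - {n - 1, n})) (Suc m)"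
      unfolding R by (rule binomial_coeff_diff_pos, unfold N) (use P in auto)
    then show "(\<beta>' (n - 1) - \<beta>' n) * coeff ([:1, -1:] * pgf \<beta>' ({1..n} - {n - 1, n})) (Suc m) > 0"
      using P by (intro mult_pos_pos) (auto simp: \<beta>'_def m)
  qed (use P assms m in \<open>auto simp: \<beta>_def \<beta>'_def intro!: monotone_onI\<close>)
qed

section \<open>Optimal orderings and their dependence on the teams\<close>

theorem theorem6:
  fixes M :: "'w measure"
    and n k :: nat
    and \<alpha> :: real
    and a b :: "nat \<Rightarrow> real"
    and X :: "nat \<Rightarrow> nat \<Rightarrow> 'w \<Rightarrow> real"
  shows
    "(linear_model M n \<alpha> a b X \<and> k \<le> n \<longrightarrow>
       (\<exists>\<mu>. (\<forall>\<sigma>. \<sigma> permutes {1..n} \<longrightarrow> expected_score M n X \<sigma> = \<mu>) \<and>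
            (real k \<ge> \<mu> + 2 \<longrightarrow> optimal_ordering M n X k id) \<and>
            (real k \<le> \<mu> - 1 \<longrightarrow> optimal_ordering M n X k (reverse_ordering n)))) \<and>
     (\<alpha> > 0 \<longrightarrow>
       (\<forall>d. -1 < d \<and> d < 2 \<longrightarrow>
         (\<exists>n k \<mu> a b a' b'
             (M :: (nat \<times> nat \<Rightarrow> bool) measure) X
             (M' :: (nat \<times> nat \<Rightarrow> bool) measure) X'.
           k \<le> n \<and> real k = \<mu> + d \<and>
           linear_model M n \<alpha> a b X \<and>
           (\<forall>\<sigma>. \<sigma> permutes {1..n} \<longrightarrow> expected_score M n X \<sigma> = \<mu>) \<and>
           linear_model M' n \<alpha> a' b' X' \<and>
           (\<forall>\<sigma>. \<sigma> permutes {1..n} \<longrightarrow> expected_score M' n X' \<sigma> = \<mu>) \<and>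
           \<not> (\<exists>\<sigma>. optimal_ordering M n X k \<sigma> \<and> optimal_ordering M' n X' k \<sigma>))))"
proof (intro conjI impI allI)
  assume "linear_model M n \<alpha> a b X \<and> k \<le> n"
  then interpret linear_model M n \<alpha> a b X by simp
  let ?\<mu> = "\<alpha> * (sum b {1..n} - sum a {1..n}) + real n / 2"
  have mean: "expected_score M n X \<sigma> = ?\<mu>" if "\<sigma> permutes {1..n}" for \<sigma>
    using expected_score_eq[OF that] sum_match_prob[OF that] by simp
  show "\<exists>\<mu>. (\<forall>\<sigma>. \<sigma> permutes {1..n} \<longrightarrow> expected_score M n X \<sigma> = \<mu>) \<and>
      (real k \<ge> \<mu> + 2 \<longrightarrow> optimal_ordering M n X k id) \<and>
      (real k \<le> \<mu> - 1 \<longrightarrow> optimal_ordering M n X k (reverse_ordering n))"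
  proof (intro exI conjI allI impI)
    show "expected_score M n X \<sigma> = ?\<mu>" if "\<sigma> permutes {1..n}" for \<sigma>
      using that by (rule mean)
    show "optimal_ordering M n X k id" if "real k \<ge> ?\<mu> + 2"
      using mean that by (rule optimal_id)
    show "optimal_ordering M n X k (reverse_ordering n)" if "real k \<le> ?\<mu> - 1"
      using mean that by (rule optimal_reverse)
  qed
next
  fix d :: real
  assume "\<alpha> > 0" and "-1 < d \<and> d < 2"
  then have "conflict_at_offset \<alpha> d"
    using conflicting_models_small[of \<alpha> d] conflicting_models_large[of \<alpha> d] by (cases "d < 1") auto
  then show "\<exists>n k \<mu> a b a' b'
             (M :: (nat \<times> nat \<Rightarrow> bool) measure) X
             (M' :: (nat \<times> nat \<Rightarrow> bool) measure) X'.
           k \<le> n \<and> real k = \<mu> + d \<and>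
           linear_model M n \<alpha> a b X \<and>
           (\<forall>\<sigma>. \<sigma> permutes {1..n} \<longrightarrow> expected_score M n X \<sigma> = \<mu>) \<and>
           linear_model M' n \<alpha> a' b' X' \<and>
           (\<forall>\<sigma>. \<sigma> permutes {1..n} \<longrightarrow> expected_score M' n X' \<sigma> = \<mu>) \<and>
           \<not> (\<exists>\<sigma>. optimal_ordering M n X k \<sigma> \<and> optimal_ordering M' n X' k \<sigma>)"
    unfolding conflict_at_offset_def .
qed

end
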